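(* Let $m$ be a positive integer with $m=m_1+m_2$, where $0\le m_1,m_2\le m$ are integers. Let $S_1=T_1=\prod_{j=1}^{2m_1}J\subset\mathbb{Z}_4^{2m_1}$ and $$S_{10}=\bigcup_{\substack{0\le i\le 2m_1\\ i\equiv0,1\bmod 4}}B_{m_1,i},\qquad S_{11}=\bigcup_{\substack{0\le i\le 2m_1\\ i\equiv2,3\bmod 4}}B_{m_1,i},$$ which form a partition of $S_1$. Let $S_2=T_2=\prod_{j=1}^{m_2}L\subset\mathbb{Z}_4^{2m_2}$ and $$S_{20}=\begin{cases}\bigcup_{i=0}^{(m_2-1)/2}E_{m_2,2i+1}& m_2\text{ odd},\\ \bigcup_{i=0}^{m_2/2}E_{m_2,2i}& m_2\text{ even},\end{cases}\qquad S_{21}=\begin{cases}\bigcup_{i=0}^{(m_2-1)/2}E_{m_2,2i}& m_2\text{ odd},\\ \bigcup_{i=0}^{m_2/2-1}E_{m_2,2i+1}& m_2\text{ even},\end{cases}$$ which form a partition of $S_2$. Define two subsets of $\mathbb{Z}_2\times\mathbb{Z}_4^{2m}=\mathbb{Z}_2\times\mathbb{Z}_4^{2m_1}\times\mathbb{Z}_4^{2m_2}$ by $$S'=\{(0,x_1,x_2)\mid(x_1,x_2)\in S_0'\}\cup\{(1,x_1,x_2)\mid(x_1,x_2)\in S_1'\},$$ $$T'=\{(0,x_1,x_2)\mid(x_1,x_2)\in T_1\times T_2\}\cup\{(1,x_1,x_2)\mid(x_1,x_2)\in T_1^{(-1)}\times T_2^{(-1)}\},$$ where $$S_0'=(S_{10}\times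 S_{20})\cup(S_{11}\times S_{21}),\qquad S_1'=(S_{10}\times S_{21})\cup(S_{11}\times S_{20}).$$ Then $S'$ and $T'$ form a primitive formally dual pair in $\mathbb{Z}_2\times\mathbb{Z}_4^{2m}$ (under the canonical isomorphism $(w,z)\mapsto\phi_{w,z}$). Moreover, $$\theta(T',\mathbb{Z}_2\times\mathbb{Z}_4^{2m})=2^{4m+1}-3^{2m_1}13^{m_2}-(2\cdot3^{2m_1}-2^{2m_1})10^{m_2}.$$
   Context: $J=\{0,1\}\subset\mathbb{Z}_4$. For $0\le i\le 2n$, $B_{n,i}$ is the set of $x\in\mathbb{Z}_4^{2n}$ with exactly $2n-i$ coordinates equal to $0$ and exactly $i$ coordinates equal to $1$. $L=\{(0,0),(0,1),(1,0),(3,3)\}$, $L_1=\{(0,0),(0,1),(1,0)\}$, $L_2=\{(3,3)\}$ (subsets of $\mathbb{Z}_4^2$). For $0\le i\le n$, $E_{n,i}\subset\mathbb{Z}_4^{2n}$ is the union of all products $\prod_{j=1}^nN_j$ with $N_j\in\{L_1,L_2\}$, exactly $i$ of the $N_j$ equal to $L_1$ and $n-i$ equal to $L_2$. When $m_1=0$ or $m_2=0$ the corresponding factor is the trivial group (empty product, a single point, with $B_{0,0}$, $E_{0,0}$ being that point), and empty unions are empty. The group operation is componentwise addition; for a subset $A$ of a finite abelian group $G$ (written additively), $A^{(-1)}=\{-a\mid a\in A\}$, $\nu_A(y)=|\{(a_1,a_2)\in A\times A\mid y=a_1-a_2\}|$, $\chi(A)=\sum_{a\in A}\chi(a)$ for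 a character $\chi$ of $G$, and $\theta(A,G)$ is the number of $g\in G$ with $\nu_A(g)=0$. Formally dual pair: given an isomorphism $\Delta:G\to\widehat G$, $\Delta(y)=\chi_y$, subsets $S,T$ of $G$ form a formally dual pair under $\Delta$ if $|\chi_y(S)|^2=\frac{|S|^2}{|T|}\nu_T(y)$ for each $y\in G$. A subset of $G$ is primitive if it is not contained in a coset of a proper subgroup of $G$ and is not a union of cosets of a nontrivial subgroup of $G$; a formally dual pair is primitive if both subsets are primitive. Canonical isomorphism for $\mathbb{Z}_2\times\mathbb{Z}_4^n$: $(w,z)\mapsto\phi_{w,z}$ with $\phi_{w,z}((a,b))=(-1)^{wa}(\sqrt{-1})^{z\cdot b}$, where $z\cdot b=\sum_{i=1}^n z_ib_i$. *)

theory Defs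
  imports Complex_Main "HOL-Algebra.Algebra"
begin

text \<open>
  Finite abelian groups are groups of \<open>HOL-Algebra\<close>; their operation, written additively in
  the mathematical text, appears as \<open>\<otimes>\<close>. Accordingly \<open>A\<^sup>(\<^sup>-\<^sup>1\<^sup>)\<close> is \<open>set_inv\<^bsub>G\<^esub> A\<close>.
\<close>

definition complex_mult_group :: "complex monoid" where
  "complex_mult_group = \<lparr>carrier = - {0}, monoid.mult = (*), one = 1\<rparr>"

text \<open>
  The character group. Characters are taken extensional, so that equality of elements of the
  character group is equality of functions on the carrier.
\<close>

definition character_group :: "('a, 'b) monoid_scheme \<Rightarrow> ('a \<Rightarrow> complex) monoid" where
  "character_group G =
    \<lparr>carrier = hom G complex_mult_group \<inter> extensional (carrier G),
     monoid.mult = (\<lambda>\<chi> \<psi>. \<lambda>a\<in>carrier G. \<chi> a * \<psi> a),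
     one = (\<lambda>a\<in>carrier G. 1)\<rparr>"

definition char_sum :: "('a \<Rightarrow> complex) \<Rightarrow> 'a set \<Rightarrow> complex" where
  "char_sum \<chi> A = (\<Sum>a\<in>A. \<chi> a)"

definition diff_count :: "('a, 'b) monoid_scheme \<Rightarrow> 'a set \<Rightarrow> 'a \<Rightarrow> nat" where
  "diff_count G A y = card {(a1, a2). (a1, a2) \<in> A \<times> A \<and> y = a1 \<otimes>\<^bsub>G\<^esub> inv\<^bsub>G\<^esub> a2}"

definition theta :: "'a set \<Rightarrow> ('a, 'b) monoid_scheme \<Rightarrow> nat" where
  "theta A G = card {g \<in> carrier G. diff_count G A g = 0}"

text \<open>\<open>T\<close> is required to be nonempty because the defining equation divides by \<open>card T\<close>.\<close>

definition formally_dual_pair ::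
  "('a, 'b) monoid_scheme \<Rightarrow> ('a \<Rightarrow> 'a \<Rightarrow> complex) \<Rightarrow> 'a set \<Rightarrow> 'a set \<Rightarrow> bool" where
  "formally_dual_pair G \<Delta> S T \<longleftrightarrow>
     \<Delta> \<in> iso G (character_group G) \<and>
     S \<subseteq> carrier G \<and> T \<subseteq> carrier G \<and> T \<noteq> {} \<and>
     (\<forall>y\<in>carrier G.
        (cmod (char_sum (\<Delta> y) S))\<^sup>2 = (real (card S))\<^sup>2 / real (card T) * real (diff_count G T y))"

definition primitive_subset :: "('a, 'b) monoid_scheme \<Rightarrow> 'a set \<Rightarrow> bool" where
  "primitive_subset G A \<longleftrightarrow>
     A \<subseteq> carrier G \<and>
     \<not> (\<exists>H. subgroup H G \<and> H \<noteq> carrier G \<and> (\<exists>C \<in> rcosets\<^bsub>G\<^esub> H. A \<subseteq> C)) \<and>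
     \<not> (\<exists>H. subgroup H G \<and> H \<noteq> {\<one>\<^bsub>G\<^esub>} \<and> (\<exists>\<C>. \<C> \<subseteq> rcosets\<^bsub>G\<^esub> H \<and> A = \<Union>\<C>))"

definition primitive_formally_dual_pair ::
  "('a, 'b) monoid_scheme \<Rightarrow> ('a \<Rightarrow> 'a \<Rightarrow> complex) \<Rightarrow> 'a set \<Rightarrow> 'a set \<Rightarrow> bool" where
  "primitive_formally_dual_pair G \<Delta> S T \<longleftrightarrow>
     formally_dual_pair G \<Delta> S T \<and> primitive_subset G S \<and> primitive_subset G T"

text \<open>
  \<^const>\<open>integer_mod_group\<close> \<open>k\<close> has carrier \<open>{0..<k}\<close>, so residues are their least nonnegative
  representatives. Coordinates are indexed from 0: \<open>\<int>\<^sub>4\<^sup>n\<close> consists of the functions in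
  \<open>{..<n} \<rightarrow>\<^sub>E {0..<4}\<close>, which for \<open>n = 0\<close> is a single point.
\<close>

definition Z4_pow :: "nat \<Rightarrow> (nat \<Rightarrow> int) monoid" where
  "Z4_pow n = product_group {..<n} (\<lambda>_. integer_mod_group 4)"

definition Z2_Z4_pow :: "nat \<Rightarrow> (int \<times> (nat \<Rightarrow> int)) monoid" where
  "Z2_Z4_pow n = integer_mod_group 2 \<times>\<times> Z4_pow n"

definition canonical_iso ::
  "nat \<Rightarrow> int \<times> (nat \<Rightarrow> int) \<Rightarrow> int \<times> (nat \<Rightarrow> int) \<Rightarrow> complex" where
  "canonical_iso n = (\<lambda>(w, z). \<lambda>(a, b)\<in>carrier (Z2_Z4_pow n).
     (- 1) powi (w * a) * \<i> powi (\<Sum>i<n. z i * b i))"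

text \<open>The identification \<open>\<int>\<^sub>4\<^sup>k \<times> \<int>\<^sub>4\<^sup>l = \<int>\<^sub>4\<^sup>k\<^sup>+\<^sup>l\<close>.\<close>

definition concat_vec :: "nat \<Rightarrow> nat \<Rightarrow> (nat \<Rightarrow> int) \<Rightarrow> (nat \<Rightarrow> int) \<Rightarrow> (nat \<Rightarrow> int)" where
  "concat_vec k l x1 x2 = (\<lambda>j\<in>{..<k + l}. if j < k then x1 j else x2 (j - k))"

definition J :: "int set" where
  "J = {0, 1}"

definition B :: "nat \<Rightarrow> nat \<Rightarrow> (nat \<Rightarrow> int) set" where
  "B n i = {x \<in> carrier (Z4_pow (2 * n)).
     card {j \<in> {..<2 * n}. x j = 0} = 2 * n - i \<and> card {j \<in> {..<2 * n}. x j = 1} = i}"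

definition S1 :: "nat \<Rightarrow> (nat \<Rightarrow> int) set" where
  "S1 m1 = (\<Pi>\<^sub>E j\<in>{..<2 * m1}. J)"

abbreviation T1 :: "nat \<Rightarrow> (nat \<Rightarrow> int) set" where
  "T1 \<equiv> S1"

definition S10 :: "nat \<Rightarrow> (nat \<Rightarrow> int) set" where
  "S10 m1 = (\<Union>i \<in> {i. i \<le> 2 * m1 \<and> i mod 4 \<in> {0, 1}}. B m1 i)"

definition S11 :: "nat \<Rightarrow> (nat \<Rightarrow> int) set" where
  "S11 m1 = (\<Union>i \<in> {i. i \<le> 2 * m1 \<and> i mod 4 \<in> {2, 3}}. B m1 i)"

definition L :: "(int \<times> int) set" where
  "L = {(0, 0), (0, 1), (1, 0), (3, 3)}"

definition L1 :: "(int \<times> int) set" where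
  "L1 = {(0, 0), (0, 1), (1, 0)}"

definition L2 :: "(int \<times> int) set" where
  "L2 = {(3, 3)}"

text \<open>
  The product of the sets \<open>N j \<subseteq> \<int>\<^sub>4\<^sup>2\<close>, \<open>j < n\<close>, inside \<open>\<int>\<^sub>4\<^sup>2\<^sup>n\<close>: the \<open>j\<close>-th factor occupies the
  coordinates \<open>2j\<close> and \<open>2j + 1\<close>.
\<close>

definition pair_prod :: "nat \<Rightarrow> (nat \<Rightarrow> (int \<times> int) set) \<Rightarrow> (nat \<Rightarrow> int) set" where
  "pair_prod n N =
     {x \<in> carrier (Z4_pow (2 * n)). \<forall>j<n. (x (2 * j), x (2 * j + 1)) \<in> N j}"

definition E :: "nat \<Rightarrow> nat \<Rightarrow> (nat \<Rightarrow> int) set" where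
  "E n i = \<Union>{pair_prod n N | N.
     (\<forall>j<n. N j \<in> {L1, L2}) \<and>
     card {j \<in> {..<n}. N j = L1} = i \<and> card {j \<in> {..<n}. N j = L2} = n - i}"

definition S2 :: "nat \<Rightarrow> (nat \<Rightarrow> int) set" where
  "S2 m2 = pair_prod m2 (\<lambda>_. L)"

abbreviation T2 :: "nat \<Rightarrow> (nat \<Rightarrow> int) set" where
  "T2 \<equiv> S2"

text \<open>
  The range \<open>0 \<le> i \<le> m2/2 - 1\<close> is written \<open>i < m2 div 2\<close>, so that it is empty for \<open>m2 = 0\<close>.
\<close>

definition S20 :: "nat \<Rightarrow> (nat \<Rightarrow> int) set" where
  "S20 m2 = (if odd m2 then (\<Union>i \<in> {0..(m2 - 1) div 2}. E m2 (2 * i + 1))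
             else (\<Union>i \<in> {0..m2 div 2}. E m2 (2 * i)))"

definition S21 :: "nat \<Rightarrow> (nat \<Rightarrow> int) set" where
  "S21 m2 = (if odd m2 then (\<Union>i \<in> {0..(m2 - 1) div 2}. E m2 (2 * i))
             else (\<Union>i \<in> {0..<m2 div 2}. E m2 (2 * i + 1)))"

definition S0' :: "nat \<Rightarrow> nat \<Rightarrow> ((nat \<Rightarrow> int) \<times> (nat \<Rightarrow> int)) set" where
  "S0' m1 m2 = S10 m1 \<times> S20 m2 \<union> S11 m1 \<times> S21 m2"

definition S1' :: "nat \<Rightarrow> nat \<Rightarrow> ((nat \<Rightarrow> int) \<times> (nat \<Rightarrow> int)) set" where
  "S1' m1 m2 = S10 m1 \<times> S21 m2 \<union> S11 m1 \<times> S20 m2"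

definition S' :: "nat \<Rightarrow> nat \<Rightarrow> (int \<times> (nat \<Rightarrow> int)) set" where
  "S' m1 m2 =
     {(0, concat_vec (2 * m1) (2 * m2) x1 x2) | x1 x2. (x1, x2) \<in> S0' m1 m2} \<union>
     {(1, concat_vec (2 * m1) (2 * m2) x1 x2) | x1 x2. (x1, x2) \<in> S1' m1 m2}"

definition T' :: "nat \<Rightarrow> nat \<Rightarrow> (int \<times> (nat \<Rightarrow> int)) set" where
  "T' m1 m2 =
     {(0, concat_vec (2 * m1) (2 * m2) x1 x2) | x1 x2. (x1, x2) \<in> T1 m1 \<times> T2 m2} \<union>
     {(1, concat_vec (2 * m1) (2 * m2) x1 x2) | x1 x2.
        (x1, x2) \<in> (set_inv\<^bsub>Z4_pow (2 * m1)\<^esub> (T1 m1)) \<times> (set_inv\<^bsub>Z4_pow (2 * m2)\<^esub> (T2 m2))}"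

end

theory Submission
  imports Defs
begin

text \<open>
  The group \<open>\<int>\<^sub>4\<^sup>2\<^sup>m\<close> is regarded as a product of \<open>m = m\<^sub>1 + m\<^sub>2\<close> copies of \<open>\<int>\<^sub>4\<^sup>2\<close> (blocks). Let \<open>T\<close> be the
  product of the planar sets \<open>F\<^sub>j\<close>, where \<open>F\<^sub>j = J \<times> J\<close> for \<open>j < m\<^sub>1\<close> and \<open>F\<^sub>j = L\<close> otherwise. Then
  \<open>T'\<close> consists of \<open>T\<close> on level 0 and \<open>-T\<close> on level 1 (the level being the
  \<open>\<int>\<^sub>2\<close>-coordinate), while \<open>S'\<close> is the graph of a function \<open>\<epsilon> : T \<rightarrow> \<int>\<^sub>2\<close>. The key observation is that
  \<open>(-1)\<^sup>\<epsilon> = Re ((1 - \<i>) * (\<Prod>j<m. g\<^sub>j (x\<^sub>j)))\<close> for the value \<open>\<epsilon>\<close> at \<open>x\<close> with blocks \<open>x\<^sub>j\<close>,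
  where \<open>g\<^sub>j (a, b) = \<i>\<^sup>a\<^sup>+\<^sup>b\<close> on \<open>J \<times> J\<close>, and on \<open>L\<close> the function \<open>g\<^sub>j\<close> is \<open>-1\<close> at \<open>(3, 3)\<close> and \<open>1\<close> at
  the other points (lemma \<open>S'_eq\<close>). This turns every quantity involved into a sum of at
  most two products over the blocks, since a sum of a product function over a product set
  factors (\<open>sum_pair_prod\<close>).

  For a character with \<open>w = 0\<close>, the sum over \<open>S'\<close> is the product of the planar sums over \<open>F\<^sub>j\<close>, and
  the number of representations by \<open>T'\<close> is twice the product of the planar numbers. For \<open>w = 1\<close>,
  the sum over \<open>S'\<close> is \<open>((1 - \<i>) P + (1 + \<i>) Q) / 2\<close>, where \<open>P\<close> and \<open>Q\<close> are the products of the
  planar sums twisted by \<open>g\<^sub>j\<close> and by its conjugate. On each block the twisted sums satisfy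
  \<open>P\<^sub>j * cnj Q\<^sub>j \<in> \<real>\<close>, and this makes the squared modulus equal to \<open>(|P|\<^sup>2 + |Q|\<^sup>2) / 2\<close> (\<open>cmod_mix\<close>).
  Up to the factor \<open>4\<close> per block, \<open>|P|\<^sup>2\<close> and \<open>|Q|\<^sup>2\<close> count the representations of \<open>z\<close> as a
  difference in \<open>(-T) - T\<close> and in \<open>T - (-T)\<close>, and the sum of these two numbers is the number of
  representations of \<open>(1, z)\<close> by \<open>T'\<close>. The planar identities are verified for each of the 16
  elements \<open>z\<close> of \<open>\<int>\<^sub>4\<^sup>2\<close>.

  An element \<open>(0, z)\<close> is a difference in \<open>T'\<close> iff \<open>z\<close> lies in the product of the supports of the
  planar counts, of sizes 9 and 13. An element \<open>(1, z)\<close> is one iff \<open>z\<close> lies in the union of two such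
  products, with supports of sizes 9 and 10 whose intersections have sizes 4 and 10. This gives
  the value of \<open>theta\<close>.

  Both subsets contain the zero element and the unit vectors of \<open>\<int>\<^sub>4\<^sup>2\<^sup>m\<close> on level 0, and an
  element on level 1, so they generate the group. If one of them is a union of cosets of \<open>H\<close>,
  then \<open>H\<close> is contained in it; an \<open>h \<in> H\<close> together with \<open>2h\<close> lies in it only if the
  \<open>\<int>\<^sub>4\<^sup>2\<^sup>m\<close>-part of \<open>h\<close> vanishes, and \<open>h = (1, 0)\<close> is excluded because \<open>T \<noteq> -T\<close>, respectively
  because \<open>S'\<close> is the graph of a function.
\<close>

section \<open>The ambient group\<close>

abbreviation Z4_sq :: "(int \<times> int) set" where
  "Z4_sq \<equiv> {0..<4} \<times> {0..<4}"

lemma carrier_Z4_pow: "carrier (Z4_pow n) = (\<Pi>\<^sub>E i\<in>{..<n}. {0..<4})"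
  by (simp add: Z4_pow_def carrier_integer_mod_group)

lemma group_Z4_pow: "group (Z4_pow n)"
  by (simp add: Z4_pow_def)

lemma mult_Z4_pow: "x \<otimes>\<^bsub>Z4_pow n\<^esub> y = (\<lambda>i\<in>{..<n}. (x i + y i) mod 4)"
  by (simp add: Z4_pow_def)

lemma one_Z4_pow: "\<one>\<^bsub>Z4_pow n\<^esub> = (\<lambda>i\<in>{..<n}. 0)"
  by (simp add: Z4_pow_def)

lemma inv_Z4_pow:
  assumes "x \<in> carrier (Z4_pow n)"
  shows "inv\<^bsub>Z4_pow n\<^esub> x = (\<lambda>i\<in>{..<n}. (- x i) mod 4)"
proof (rule group.inv_equality[OF group_Z4_pow])
  show "(\<lambda>i\<in>{..<n}. (- x i) mod 4) \<otimes>\<^bsub>Z4_pow n\<^esub> x = \<one>\<^bsub>Z4_pow n\<^esub>"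
    by (simp add: mult_Z4_pow one_Z4_pow restrict_def fun_eq_iff mod_add_left_eq)
qed (use assms in \<open>auto simp: carrier_Z4_pow\<close>)

lemma group_Z2_Z4_pow: "group (Z2_Z4_pow n)"
  unfolding Z2_Z4_pow_def by (intro DirProd_group group_Z4_pow) simp

lemma carrier_Z2_Z4_pow: "carrier (Z2_Z4_pow n) = {0, 1} \<times> (\<Pi>\<^sub>E i\<in>{..<n}. {0..<4})"
proof -
  have "{0..<2} = {0, 1 :: int}"
    by auto
  then show ?thesis
    by (simp add: Z2_Z4_pow_def carrier_Z4_pow carrier_integer_mod_group)
qed

lemma mult_Z2_Z4_pow:
  "(a, x) \<otimes>\<^bsub>Z2_Z4_pow n\<^esub> (b, y) = ((a + b) mod 2, \<lambda>i\<in>{..<n}. (x i + y i) mod 4)"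
  by (simp add: Z2_Z4_pow_def mult_Z4_pow)

lemma one_Z2_Z4_pow: "\<one>\<^bsub>Z2_Z4_pow n\<^esub> = (0, \<lambda>i\<in>{..<n}. 0)"
  by (simp add: Z2_Z4_pow_def one_Z4_pow)

lemma inv_mult_Z2_Z4_pow:
  assumes "(w, z) \<in> carrier (Z2_Z4_pow n)"
  shows "inv\<^bsub>Z2_Z4_pow n\<^esub> (w, z) \<otimes>\<^bsub>Z2_Z4_pow n\<^esub> (a, x)
           = ((a - w) mod 2, \<lambda>i\<in>{..<n}. (x i - z i) mod 4)"
proof -
  have w: "w \<in> carrier (integer_mod_group 2)" and z: "z \<in> carrier (Z4_pow n)"
    using assms by (auto simp: Z2_Z4_pow_def)
  have inv: "inv\<^bsub>Z2_Z4_pow n\<^esub> (w, z) = ((- w) mod 2, \<lambda>i\<in>{..<n}. (- z i) mod 4)"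
    unfolding Z2_Z4_pow_def
    by (simp only: inv_DirProd[OF group_integer_mod_group group_Z4_pow w z]
        inv_integer_mod_group[OF w] inv_Z4_pow[OF z] of_nat_numeral)
  show ?thesis
    unfolding inv mult_Z2_Z4_pow by (simp add: restrict_def fun_eq_iff mod_add_left_eq)
qed

text \<open>The \<open>k\<close>-th standard unit vector of \<open>\<int>\<^sub>4\<^sup>n\<close>; the zero vector if \<open>k \<ge> n\<close>.\<close>

definition unit_vec :: "nat \<Rightarrow> nat \<Rightarrow> (nat \<Rightarrow> int)" where
  "unit_vec n k = (\<lambda>i\<in>{..<n}. if i = k then 1 else 0)"

lemma unit_vec_in_carrier: "(0, unit_vec n k) \<in> carrier (Z2_Z4_pow n)"
  by (auto simp: unit_vec_def carrier_Z2_Z4_pow)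

text \<open>By induction on the sum of the coordinates, removing one unit vector at a time.\<close>

lemma subgroup_contains_Z4_part:
  assumes H: "subgroup H (Z2_Z4_pow n)"
    and units: "\<And>k. k < n \<Longrightarrow> (0, unit_vec n k) \<in> H"
    and x: "x \<in> (\<Pi>\<^sub>E i\<in>{..<n}. {0..<4})"
  shows "(0, x) \<in> H"
  using x
proof (induction "\<Sum>k<n. nat (x k)" arbitrary: x rule: less_induct)
  case less
  show ?case
  proof (cases "\<exists>k<n. x k > 0")
    case False
    then have "x k = 0" if "k < n" for k
      using less.prems that by (force simp: PiE_iff)
    then have "x = (\<lambda>i\<in>{..<n}. 0)"
      using less.prems by (auto simp: PiE_iff extensional_def fun_eq_iff)
    then show ?thesis
      using subgroup.one_closed[OF H] by (simp add: one_Z2_Z4_pow)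
  next
    case True
    then obtain k where k: "k < n" "x k > 0" by blast
    define y where "y = x(k := x k - 1)"
    have y: "y \<in> (\<Pi>\<^sub>E i\<in>{..<n}. {0..<4})"
    proof (rule PiE_I)
      fix i assume "i \<in> {..<n}"
      then have "x i \<in> {0..<4}"
        using less.prems by blast
      then show "y i \<in> {0..<4}"
        using k by (auto simp: y_def)
    qed (use less.prems k in \<open>auto simp: y_def PiE_iff extensional_def\<close>)
    have "(\<Sum>i<n. nat (y i)) < (\<Sum>i<n. nat (x i))"
      using k by (intro sum_strict_mono_ex1) (auto simp: y_def)
    then have "(0, y) \<in> H"
      using less.hyps y by blast
    then have "(0, y) \<otimes>\<^bsub>Z2_Z4_pow n\<^esub> (0, unit_vec n k) \<in> H"
      using units k subgroup.m_closed[OF H] by blast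
    moreover have "(\<lambda>i\<in>{..<n}. (y i + unit_vec n k i) mod 4) = x"
      using less.prems k
      by (auto simp: y_def unit_vec_def fun_eq_iff PiE_iff extensional_def)
    ultimately show ?thesis
      by (simp add: mult_Z2_Z4_pow)
  qed
qed

lemma subgroup_eq_Z2_Z4_powI:
  assumes H: "subgroup H (Z2_Z4_pow n)"
    and units: "\<And>k. k < n \<Longrightarrow> (0, unit_vec n k) \<in> H"
    and "(1, y) \<in> H"
  shows "H = carrier (Z2_Z4_pow n)"
proof
  show "H \<subseteq> carrier (Z2_Z4_pow n)"
    using H by (rule subgroup.subset)
  have y: "y \<in> (\<Pi>\<^sub>E i\<in>{..<n}. {0..<4})"
    using subgroup.mem_carrier[OF H \<open>(1, y) \<in> H\<close>] by (simp add: carrier_Z2_Z4_pow)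
  show "carrier (Z2_Z4_pow n) \<subseteq> H"
  proof
    fix g assume g: "g \<in> carrier (Z2_Z4_pow n)"
    obtain a x where ax: "g = (a, x)" by (cases g)
    have a: "a = 0 \<or> a = 1" and x: "x \<in> (\<Pi>\<^sub>E i\<in>{..<n}. {0..<4})"
      using g by (auto simp: ax carrier_Z2_Z4_pow)
    show "g \<in> H"
    proof (cases "a = 0")
      case True
      then show ?thesis
        using subgroup_contains_Z4_part[OF H units x] ax by simp
    next
      case False
      define u where "u = (\<lambda>i\<in>{..<n}. (x i - y i) mod 4)"
      have "u \<in> (\<Pi>\<^sub>E i\<in>{..<n}. {0..<4})"
        by (auto simp: u_def)
      then have "(0, u) \<in> H"
        using subgroup_contains_Z4_part[OF H] units by blast
      then have "(0, u) \<otimes>\<^bsub>Z2_Z4_pow n\<^esub> (1, y) \<in> H"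
        using \<open>(1, y) \<in> H\<close> subgroup.m_closed[OF H] by blast
      moreover have "(\<lambda>i\<in>{..<n}. (u i + y i) mod 4) = x"
        using x by (auto simp: u_def fun_eq_iff PiE_iff extensional_def mod_add_left_eq)
      ultimately show ?thesis
        using a False by (simp add: mult_Z2_Z4_pow ax)
    qed
  qed
qed

section \<open>The canonical isomorphism\<close>

lemma i_powi_mod_4: "\<i> powi (k mod 4) = \<i> powi k"
proof -
  have "\<i> powi k = \<i> powi (4 * (k div 4) + k mod 4)"
    by simp
  also have "\<dots> = (\<i> powi 4) powi (k div 4) * \<i> powi (k mod 4)"
    by (subst power_int_add) (auto simp: power_int_mult)
  also have "\<i> powi 4 = 1"
    by simp
  finally show ?thesis
    by simp
qed

lemma i_powi_cong: "k mod 4 = l mod 4 \<Longrightarrow> \<i> powi k = \<i> powi l"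
  by (metis i_powi_mod_4)

lemma minus_one_powi_mod_2: "(- 1 :: complex) powi (k mod 2) = (- 1) powi k"
proof -
  have "(- 1 :: complex) powi k = (- 1) powi (2 * (k div 2) + k mod 2)"
    by simp
  also have "\<dots> = ((- 1) powi 2) powi (k div 2) * (- 1) powi (k mod 2)"
    by (subst power_int_add) (auto simp: power_int_mult)
  finally show ?thesis
    by simp
qed

lemma i_powi_sum: "\<i> powi (\<Sum>k\<in>A. f k) = (\<Prod>k\<in>A. \<i> powi f k)"
  by (induction A rule: infinite_finite_induct) (auto simp: power_int_add)

lemma i_powi_inj:
  assumes "\<i> powi a = \<i> powi b" "a \<in> {0..<4}" "b \<in> {0..<4}"
  shows "a = b"
proof -
  have "{0..<4} = {0, 1, 2, 3 :: int}" by auto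
  then have "a \<in> {0, 1, 2, 3}" "b \<in> {0, 1, 2, 3}"
    using assms by auto
  then show ?thesis
    using assms(1) by (auto simp: power3_eq_cube complex_eq_iff)
qed

lemma canonical_iso_apply:
  assumes "(a, b) \<in> carrier (Z2_Z4_pow n)"
  shows "canonical_iso n (w, z) (a, b) = (- 1) powi (w * a) * (\<Prod>k<n. \<i> powi (z k * b k))"
  using assms by (simp add: canonical_iso_def i_powi_sum)

text \<open>\<open>canonical_iso\<close> is symmetric in its two arguments, so being a homomorphism into the
  character group and having homomorphisms as values are the same fact.\<close>

lemma canonical_iso_commute:
  assumes "(a, b) \<in> carrier (Z2_Z4_pow n)" "(w, z) \<in> carrier (Z2_Z4_pow n)"
  shows "canonical_iso n (w, z) (a, b) = canonical_iso n (a, b) (w, z)"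
  using assms by (simp add: canonical_iso_apply mult.commute)

lemma canonical_iso_mult:
  assumes "g \<in> carrier (Z2_Z4_pow n)" "h \<in> carrier (Z2_Z4_pow n)"
  shows "canonical_iso n y (g \<otimes>\<^bsub>Z2_Z4_pow n\<^esub> h) = canonical_iso n y g * canonical_iso n y h"
proof -
  obtain a b c d w z where [simp]: "g = (a, b)" "h = (c, d)" "y = (w, z)"
    by (metis prod.exhaust)
  have gh: "g \<otimes>\<^bsub>Z2_Z4_pow n\<^esub> h \<in> carrier (Z2_Z4_pow n)"
    using assms group.is_monoid[OF group_Z2_Z4_pow] by (meson monoid.m_closed)
  have 1: "(- 1 :: complex) powi (w * ((a + c) mod 2)) = (- 1) powi (w * a) * (- 1) powi (w * c)"
  proof -
    have "(- 1 :: complex) powi (w * ((a + c) mod 2)) = (- 1) powi ((w * ((a + c) mod 2)) mod 2)"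
      by (simp add: minus_one_powi_mod_2)
    also have "\<dots> = (- 1) powi (w * a + w * c)"
      by (simp add: minus_one_powi_mod_2 mod_mult_right_eq distrib_left)
    finally show ?thesis
      by (simp add: power_int_add)
  qed
  have 2: "\<i> powi (z k * ((b k + d k) mod 4)) = \<i> powi (z k * b k) * \<i> powi (z k * d k)" for k
  proof -
    have "\<i> powi (z k * ((b k + d k) mod 4)) = \<i> powi (z k * b k + z k * d k)"
      by (rule i_powi_cong) (simp add: mod_mult_right_eq distrib_left)
    then show ?thesis
      by (simp add: power_int_add)
  qed
  show ?thesis
    using assms gh
    by (simp add: mult_Z2_Z4_pow canonical_iso_apply 1 2 prod.distrib mult_ac)
qed

lemma canonical_iso_nonzero:
  assumes "g \<in> carrier (Z2_Z4_pow n)"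
  shows "canonical_iso n y g \<noteq> 0"
  using assms by (cases g; cases y) (simp add: canonical_iso_apply)

lemma canonical_iso_in_character_group:
  "canonical_iso n y \<in> carrier (character_group (Z2_Z4_pow n))"
proof -
  have "canonical_iso n y \<in> extensional (carrier (Z2_Z4_pow n))"
    by (cases y) (simp add: canonical_iso_def)
  then show ?thesis
    by (auto simp: character_group_def hom_def complex_mult_group_def
        canonical_iso_mult canonical_iso_nonzero)
qed

lemma canonical_iso_unit_vec:
  assumes "k < n"
  shows "canonical_iso n (w, z) (0, unit_vec n k) = \<i> powi (z k)"
proof -
  have "(\<Prod>i<n. \<i> powi (z i * unit_vec n k i)) = (\<Prod>i<n. if i = k then \<i> powi (z k) else 1)"
    by (rule prod.cong) (auto simp: unit_vec_def)
  then show ?thesis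
    using assms by (simp add: canonical_iso_apply unit_vec_in_carrier)
qed

lemma canonical_iso_Z2_unit:
  "canonical_iso n (w, z) (1, \<lambda>i\<in>{..<n}. 0) = (- 1) powi w"
  by (subst canonical_iso_apply) (auto simp: carrier_Z2_Z4_pow)

text \<open>Characters agreeing on generators agree, since the set where they agree is a subgroup.\<close>

lemma character_eqI:
  assumes \<chi>: "\<chi> \<in> carrier (character_group (Z2_Z4_pow n))"
    and \<psi>: "\<psi> \<in> carrier (character_group (Z2_Z4_pow n))"
    and units: "\<And>k. k < n \<Longrightarrow> \<chi> (0, unit_vec n k) = \<psi> (0, unit_vec n k)"
    and Z2: "\<chi> (1, \<lambda>i\<in>{..<n}. 0) = \<psi> (1, \<lambda>i\<in>{..<n}. 0)"
  shows "\<chi> = \<psi>"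
proof -
  let ?G = "Z2_Z4_pow n"
  interpret G: group ?G by (rule group_Z2_Z4_pow)
  have mult: "\<phi> (g \<otimes>\<^bsub>?G\<^esub> h) = \<phi> g * \<phi> h"
    if "\<phi> \<in> {\<chi>, \<psi>}" "g \<in> carrier ?G" "h \<in> carrier ?G" for \<phi> g h
    using that \<chi> \<psi> by (auto simp: character_group_def hom_def complex_mult_group_def)
  have nz: "\<phi> g \<noteq> 0" if "\<phi> \<in> {\<chi>, \<psi>}" "g \<in> carrier ?G" for \<phi> g
    using that \<chi> \<psi> by (auto simp: character_group_def hom_def complex_mult_group_def)
  have one: "\<phi> \<one>\<^bsub>?G\<^esub> = 1" if "\<phi> \<in> {\<chi>, \<psi>}" for \<phi>
    using mult[OF that, of "\<one>\<^bsub>?G\<^esub>" "\<one>\<^bsub>?G\<^esub>"] nz[OF that, of "\<one>\<^bsub>?G\<^esub>"] by simp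
  have inv: "\<phi> (inv\<^bsub>?G\<^esub> g) = inverse (\<phi> g)" if "\<phi> \<in> {\<chi>, \<psi>}" "g \<in> carrier ?G" for \<phi> g
    using mult[OF that(1), of g "inv\<^bsub>?G\<^esub> g"] one[OF that(1)] nz[OF that] that(2)
    by (simp add: field_simps)
  define H where "H = {g \<in> carrier ?G. \<chi> g = \<psi> g}"
  have "\<one>\<^bsub>?G\<^esub> \<in> H"
    using one[of \<chi>] one[of \<psi>] by (simp add: H_def)
  then have "subgroup H ?G"
  proof (intro G.subgroupI)
    show "inv\<^bsub>?G\<^esub> g \<in> H" if "g \<in> H" for g
      using that inv[of \<chi> g] inv[of \<psi> g] by (simp add: H_def)
    show "g \<otimes>\<^bsub>?G\<^esub> h \<in> H" if "g \<in> H" "h \<in> H" for g h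
      using that mult[of \<chi> g h] mult[of \<psi> g h] by (simp add: H_def)
    show "H \<noteq> {}"
      using \<open>\<one>\<^bsub>?G\<^esub> \<in> H\<close> by blast
  qed (simp add: H_def subset_iff)
  moreover have "(0, unit_vec n k) \<in> H" if "k < n" for k
    using that units by (simp add: H_def unit_vec_in_carrier)
  moreover have "(1, \<lambda>i\<in>{..<n}. 0) \<in> H"
    using Z2 by (auto simp: H_def carrier_Z2_Z4_pow)
  ultimately have "H = carrier ?G"
    by (rule subgroup_eq_Z2_Z4_powI)
  then have "\<chi> g = \<psi> g" if "g \<in> carrier ?G" for g
    using that by (auto simp: H_def)
  moreover have "\<chi> \<in> extensional (carrier ?G)" "\<psi> \<in> extensional (carrier ?G)"
    using \<chi> \<psi> by (auto simp: character_group_def)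
  ultimately show ?thesis
    by (rule extensionalityI[rotated 2])
qed

lemma canonical_iso_is_iso: "canonical_iso n \<in> iso (Z2_Z4_pow n) (character_group (Z2_Z4_pow n))"
proof -
  let ?G = "Z2_Z4_pow n"
  interpret G: group ?G by (rule group_Z2_Z4_pow)
  have hom: "canonical_iso n \<in> hom ?G (character_group ?G)"
  proof (rule homI)
    fix g h assume gh: "g \<in> carrier ?G" "h \<in> carrier ?G"
    have comm: "canonical_iso n u v = canonical_iso n v u"
      if "u \<in> carrier ?G" "v \<in> carrier ?G" for u v
      using that canonical_iso_commute by (metis prod.exhaust)
    have ext: "canonical_iso n u \<in> extensional (carrier ?G)" for u
      using canonical_iso_in_character_group[of n u] by (simp add: character_group_def)
    have "canonical_iso n (g \<otimes>\<^bsub>?G\<^esub> h) v = canonical_iso n g v * canonical_iso n h v"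
      if v: "v \<in> carrier ?G" for v
      using gh v by (simp add: comm[of _ v] canonical_iso_mult)
    then show "canonical_iso n (g \<otimes>\<^bsub>?G\<^esub> h)
      = canonical_iso n g \<otimes>\<^bsub>character_group ?G\<^esub> canonical_iso n h"
      using ext[of "g \<otimes>\<^bsub>?G\<^esub> h"]
      by (auto simp: character_group_def fun_eq_iff extensional_def)
  qed (rule canonical_iso_in_character_group)
  have inj: "inj_on (canonical_iso n) (carrier ?G)"
  proof (rule inj_onI)
    fix g h assume gh: "g \<in> carrier ?G" "h \<in> carrier ?G" "canonical_iso n g = canonical_iso n h"
    obtain a b c d where [simp]: "g = (a, b)" "h = (c, d)"
      by (metis prod.exhaust)
    have "b k = d k" if "k < n" for k
      using canonical_iso_unit_vec[OF that, of a b] canonical_iso_unit_vec[OF that, of c d] gh that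
      by (intro i_powi_inj) (auto simp: carrier_Z2_Z4_pow PiE_iff)
    then have "b = d"
      using gh by (intro PiE_ext[of b "{..<n}" "\<lambda>_. {0..<4}"]) (auto simp: carrier_Z2_Z4_pow)
    moreover have "(- 1 :: complex) powi a = (- 1) powi c"
      using canonical_iso_Z2_unit[of n a b] canonical_iso_Z2_unit[of n c d] gh(3) by simp
    then have "a = c"
      using gh(1,2) unfolding carrier_Z2_Z4_pow by (elim SigmaE insertE) simp_all
    ultimately show "g = h"
      by simp
  qed
  have surj: "\<chi> \<in> canonical_iso n ` carrier ?G" if \<chi>: "\<chi> \<in> carrier (character_group ?G)" for \<chi>
  proof -
    have mult: "\<chi> (g \<otimes>\<^bsub>?G\<^esub> h) = \<chi> g * \<chi> h" if "g \<in> carrier ?G" "h \<in> carrier ?G" for g h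
      using that \<chi> by (auto simp: character_group_def hom_def complex_mult_group_def)
    have nz: "\<chi> g \<noteq> 0" if "g \<in> carrier ?G" for g
      using that \<chi> by (auto simp: character_group_def hom_def complex_mult_group_def)
    have one: "\<chi> \<one>\<^bsub>?G\<^esub> = 1"
      using mult[of "\<one>\<^bsub>?G\<^esub>" "\<one>\<^bsub>?G\<^esub>"] nz[of "\<one>\<^bsub>?G\<^esub>"] by simp
    let ?e = "(1, \<lambda>i\<in>{..<n}. 0) :: int \<times> (nat \<Rightarrow> int)"
    have "?e \<in> carrier ?G"
      by (auto simp: carrier_Z2_Z4_pow)
    moreover have "?e \<otimes>\<^bsub>?G\<^esub> ?e = \<one>\<^bsub>?G\<^esub>"
      by (simp add: mult_Z2_Z4_pow one_Z2_Z4_pow restrict_def fun_eq_iff)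
    ultimately have "\<chi> ?e * \<chi> ?e = 1"
      using mult[of ?e ?e] one by simp
    then have "\<chi> ?e = 1 \<or> \<chi> ?e = - 1"
      by (simp add: square_eq_1_iff)
    then obtain w where w: "w \<in> {0, 1}" "\<chi> ?e = (- 1) powi w"
      by (metis insert_iff power_int_0_right power_int_1_right)
    have "\<exists>c. c \<in> {0..<4} \<and> \<chi> (0, unit_vec n k) = \<i> powi c" for k
    proof -
      let ?u = "(0, unit_vec n k) :: int \<times> (nat \<Rightarrow> int)"
      let ?v = "?u \<otimes>\<^bsub>?G\<^esub> ?u"
      have "?v \<otimes>\<^bsub>?G\<^esub> ?v = \<one>\<^bsub>?G\<^esub>"
        by (simp add: mult_Z2_Z4_pow one_Z2_Z4_pow restrict_def fun_eq_iff unit_vec_def)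
      then have "(\<chi> ?u * \<chi> ?u) * (\<chi> ?u * \<chi> ?u) = 1"
        using mult[of ?u ?u] mult[of ?v ?v] one unit_vec_in_carrier by simp
      then have "(\<chi> ?u - 1) * (\<chi> ?u + 1) * (\<chi> ?u - \<i>) * (\<chi> ?u + \<i>) = 0"
        by (simp add: algebra_simps)
      then have "\<chi> ?u = 1 \<or> \<chi> ?u = - 1 \<or> \<chi> ?u = \<i> \<or> \<chi> ?u = - \<i>"
        by (auto simp: eq_neg_iff_add_eq_0)
      then have "\<chi> ?u = \<i> powi 0 \<or> \<chi> ?u = \<i> powi 2 \<or> \<chi> ?u = \<i> powi 1 \<or> \<chi> ?u = \<i> powi 3"
        by (simp add: power3_eq_cube)
      then have "\<exists>c\<in>{0, 1, 2, 3}. \<chi> ?u = \<i> powi c"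
        by blast
      moreover have "{0, 1, 2, 3 :: int} \<subseteq> {0..<4}"
        by auto
      ultimately show ?thesis
        by (meson subsetD)
    qed
    then obtain c where c: "c k \<in> {0..<4} \<and> \<chi> (0, unit_vec n k) = \<i> powi c k" for k
      by metis
    define z where "z = (\<lambda>k\<in>{..<n}. c k)"
    have "\<chi> = canonical_iso n (w, z)"
    proof (rule character_eqI[OF \<chi> canonical_iso_in_character_group])
      show "\<chi> (0, unit_vec n k) = canonical_iso n (w, z) (0, unit_vec n k)" if "k < n" for k
        using c that by (simp add: canonical_iso_unit_vec z_def)
      show "\<chi> ?e = canonical_iso n (w, z) ?e"
        using w by (simp only: canonical_iso_Z2_unit)
    qed
    moreover have "(w, z) \<in> carrier ?G"
      using w c by (auto simp: carrier_Z2_Z4_pow z_def)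
    ultimately show ?thesis
      by blast
  qed
  have "bij_betw (canonical_iso n) (carrier ?G) (carrier (character_group ?G))"
    unfolding bij_betw_def
  proof
    show "canonical_iso n ` carrier ?G = carrier (character_group ?G)"
      using surj canonical_iso_in_character_group by blast
  qed (rule inj)
  then show ?thesis
    using hom by (simp add: iso_def)
qed

section \<open>Products of planar sets\<close>

text \<open>The \<open>j\<close>-th pair of coordinates. Both kinds of factor, \<open>J \<times> J\<close> and \<open>L\<close>, are subsets of
  \<open>\<int>\<^sub>4\<^sup>2\<close>, so that \<open>S\<^sub>1 \<times> S\<^sub>2\<close> is a product of \<open>m\<close> planar sets in the sense of \<^const>\<open>pair_prod\<close>.\<close>

definition block :: "(nat \<Rightarrow> int) \<Rightarrow> nat \<Rightarrow> int \<times> int" where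
  "block x j = (x (2 * j), x (2 * j + 1))"

lemma pair_prod_iff:
  "x \<in> pair_prod n N \<longleftrightarrow> x \<in> carrier (Z4_pow (2 * n)) \<and> (\<forall>j<n. block x j \<in> N j)"
  by (simp add: pair_prod_def block_def)

lemma block_restrict: "j < n \<Longrightarrow> block (\<lambda>i\<in>{..<2 * n}. f i) j = (f (2 * j), f (2 * j + 1))"
  by (simp add: block_def)

lemma all_less_double: "(\<forall>k<2 * n. P k) \<longleftrightarrow> (\<forall>j<n. P (2 * j) \<and> P (2 * j + 1))" for n :: nat
proof
  assume R: "\<forall>j<n. P (2 * j) \<and> P (2 * j + 1)"
  show "\<forall>k<2 * n. P k"
  proof (intro allI impI)
    fix k assume "k < 2 * n"
    then have "k div 2 < n"
      by simp
    then have "P (2 * (k div 2))" "P (2 * (k div 2) + 1)"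
      using R by blast+
    then show "P k"
      by (cases "even k") (metis dvd_mult_div_cancel, metis odd_two_times_div_two_succ)
  qed
qed auto

lemma prod_double: "(\<Prod>k<2 * n. f k) = (\<Prod>j<n. f (2 * j) * f (2 * j + 1))"
  for f :: "nat \<Rightarrow> 'a :: comm_monoid_mult"
  by (induction n) (simp_all add: mult.assoc)

lemma sum_double: "(\<Sum>k<2 * n. f k) = (\<Sum>j<n. f (2 * j) + f (2 * j + 1))"
  for f :: "nat \<Rightarrow> 'a :: comm_monoid_add"
  by (induction n) (simp_all add: add.assoc)

lemma carrier_Z4_pow_iff:
  "x \<in> carrier (Z4_pow (2 * n)) \<longleftrightarrow> x \<in> extensional {..<2 * n} \<and> (\<forall>j<n. block x j \<in> Z4_sq)"
proof -
  have "x \<in> carrier (Z4_pow (2 * n)) \<longleftrightarrow> x \<in> extensional {..<2 * n} \<and> (\<forall>k<2 * n. x k \<in> {0..<4})"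
    unfolding carrier_Z4_pow PiE_iff by blast
  then show ?thesis
    unfolding all_less_double block_def by simp
qed

lemma block_in_Z4_sq: "x \<in> carrier (Z4_pow (2 * n)) \<Longrightarrow> j < n \<Longrightarrow> block x j \<in> Z4_sq"
  by (simp add: carrier_Z4_pow_iff)

lemma block_ext:
  assumes "x \<in> extensional {..<2 * n}" "y \<in> extensional {..<2 * n}" "\<And>j. j < n \<Longrightarrow> block x j = block y j"
  shows "x = y"
proof (rule extensionalityI[OF assms(1,2)])
  have "\<forall>k<2 * n. x k = y k"
    unfolding all_less_double using assms(3) by (simp add: block_def)
  then show "x k = y k" if "k \<in> {..<2 * n}" for k
    using that by simp
qed

lemma finite_Z4_sq_subset: "A \<subseteq> Z4_sq \<Longrightarrow> finite A"
  by (rule finite_subset) auto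

text \<open>Reading off the blocks identifies \<open>\<int>\<^sub>4\<^sup>2\<^sup>n\<close> with the functions from \<open>{..<n}\<close> to \<open>\<int>\<^sub>4\<^sup>2\<close>, and thereby
  \<^const>\<open>pair_prod\<close> with a dependent function space.\<close>

lemma bij_betw_pair_prod:
  assumes "\<And>j. j < n \<Longrightarrow> N j \<subseteq> Z4_sq"
  shows "bij_betw (\<lambda>x. \<lambda>j\<in>{..<n}. block x j) (pair_prod n N) (PiE {..<n} N)"
proof -
  let ?unblock = "\<lambda>p. \<lambda>k\<in>{..<2 * n}. if even k then fst (p (k div 2)) else snd (p (k div 2))"
  have bl: "block (?unblock p) j = p j" if "j < n" for j and p :: "nat \<Rightarrow> int \<times> int"
    using that by (simp add: block_def)
  show ?thesis
  proof (rule bij_betwI[where g = ?unblock])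
    show "(\<lambda>x. \<lambda>j\<in>{..<n}. block x j) \<in> pair_prod n N \<rightarrow> PiE {..<n} N"
      by (auto simp: pair_prod_iff)
    show "?unblock \<in> PiE {..<n} N \<rightarrow> pair_prod n N"
    proof
      fix p assume p: "p \<in> PiE {..<n} N"
      have "p j \<in> N j" if "j < n" for j
        using p that by blast
      then have "block (?unblock p) j \<in> N j" if "j < n" for j
        using bl[OF that, of p] that by simp
      moreover have "?unblock p \<in> extensional {..<2 * n}"
        by simp
      ultimately show "?unblock p \<in> pair_prod n N"
        unfolding pair_prod_iff carrier_Z4_pow_iff using assms by blast
    qed
    show "?unblock (\<lambda>j\<in>{..<n}. block x j) = x" if "x \<in> pair_prod n N" for x
    proof (rule block_ext)
      show "x \<in> extensional {..<2 * n}"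
        using that by (simp add: pair_prod_iff carrier_Z4_pow_iff)
    qed (simp_all add: bl)
    show "(\<lambda>j\<in>{..<n}. block (?unblock p) j) = p" if "p \<in> PiE {..<n} N" for p
      using that bl[of _ p]
      by (intro extensionalityI[of _ "{..<n}"]) (simp_all add: PiE_iff)
  qed
qed

lemma sum_pair_prod:
  fixes f :: "nat \<Rightarrow> int \<times> int \<Rightarrow> 'a :: comm_semiring_1"
  assumes "\<And>j. j < n \<Longrightarrow> N j \<subseteq> Z4_sq"
  shows "(\<Sum>x\<in>pair_prod n N. \<Prod>j<n. f j (block x j)) = (\<Prod>j<n. \<Sum>p\<in>N j. f j p)"
proof -
  have "(\<Prod>j<n. \<Sum>p\<in>N j. f j p) = (\<Sum>g\<in>PiE {..<n} N. \<Prod>j<n. f j (g j))"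
    by (rule prod_sum_PiE) (use assms finite_Z4_sq_subset in auto)
  also have "\<dots> = (\<Sum>x\<in>pair_prod n N. \<Prod>j<n. f j ((\<lambda>j\<in>{..<n}. block x j) j))"
    by (rule sum.reindex_bij_betw[OF bij_betw_pair_prod[OF assms], symmetric])
  finally show ?thesis
    by simp
qed

lemma finite_pair_prod: "finite (pair_prod n N)"
proof (rule finite_subset)
  show "pair_prod n N \<subseteq> carrier (Z4_pow (2 * n))"
    by (auto simp: pair_prod_iff)
qed (simp add: carrier_Z4_pow finite_PiE)

lemma card_pair_prod:
  assumes "\<And>j. j < n \<Longrightarrow> N j \<subseteq> Z4_sq"
  shows "card (pair_prod n N) = (\<Prod>j<n. card (N j))"
  using sum_pair_prod[OF assms, where f = "\<lambda>_ _. 1 :: nat"] by simp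

lemma pair_prod_Int: "pair_prod n N \<inter> pair_prod n N' = pair_prod n (\<lambda>j. N j \<inter> N' j)"
  by (auto simp: pair_prod_iff)

lemma pair_prod_cong: "(\<And>j. j < n \<Longrightarrow> N j = N' j) \<Longrightarrow> pair_prod n N = pair_prod n N'"
  by (simp add: pair_prod_def)

text \<open>Negation and subtraction in \<open>\<int>\<^sub>4\<^sup>2\<close>, with values reduced to \<open>{0..<4}\<close>.\<close>

definition neg_pair :: "int \<times> int \<Rightarrow> int \<times> int" where
  "neg_pair p = ((- fst p) mod 4, (- snd p) mod 4)"

definition diff_pair :: "int \<times> int \<Rightarrow> int \<times> int \<Rightarrow> int \<times> int" where
  "diff_pair p z = ((fst p - fst z) mod 4, (snd p - snd z) mod 4)"

text \<open>The number of representations \<open>z = p - q\<close> with \<open>p \<in> A\<close> and \<open>q \<in> C\<close>.\<close>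

definition pair_count :: "(int \<times> int) set \<Rightarrow> (int \<times> int) set \<Rightarrow> int \<times> int \<Rightarrow> nat" where
  "pair_count A C z = card {p \<in> A. diff_pair p z \<in> C}"

lemma neg_pair_in_Z4_sq: "neg_pair p \<in> Z4_sq"
  by (simp add: neg_pair_def)

lemma neg_neg_pair: "p \<in> Z4_sq \<Longrightarrow> neg_pair (neg_pair p) = p"
  by (cases p) (simp add: neg_pair_def mod_minus_eq)

lemma card_pair_prod_diff:
  assumes "\<And>j. j < n \<Longrightarrow> N j \<subseteq> Z4_sq"
  shows "card {x \<in> pair_prod n N. (\<lambda>i\<in>{..<2 * n}. (x i - z i) mod 4) \<in> pair_prod n N'}
           = (\<Prod>j<n. pair_count (N j) (N' j) (block z j))"
proof -
  have "(\<lambda>i\<in>{..<2 * n}. (x i - z i) mod 4) \<in> pair_prod n N'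
      \<longleftrightarrow> (\<forall>j<n. diff_pair (block x j) (block z j) \<in> N' j)" for x
    by (auto simp: pair_prod_iff carrier_Z4_pow diff_pair_def block_def)
  then have "{x \<in> pair_prod n N. (\<lambda>i\<in>{..<2 * n}. (x i - z i) mod 4) \<in> pair_prod n N'}
      = pair_prod n (\<lambda>j. {p \<in> N j. diff_pair p (block z j) \<in> N' j})"
    by (auto simp: pair_prod_iff)
  moreover have "{p \<in> N j. diff_pair p (block z j) \<in> N' j} \<subseteq> Z4_sq" if "j < n" for j
    using assms[OF that] by blast
  ultimately show ?thesis
    by (simp add: card_pair_prod pair_count_def)
qed

lemma set_inv_pair_prod:
  assumes "\<And>j. j < n \<Longrightarrow> N j \<subseteq> Z4_sq"
  shows "set_inv\<^bsub>Z4_pow (2 * n)\<^esub> (pair_prod n N) = pair_prod n (\<lambda>j. neg_pair ` N j)"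
proof -
  interpret G: group "Z4_pow (2 * n)" by (rule group_Z4_pow)
  have bl: "block (inv\<^bsub>Z4_pow (2 * n)\<^esub> x) j = neg_pair (block x j)"
    if "x \<in> carrier (Z4_pow (2 * n))" "j < n" for x j
    using that by (simp add: inv_Z4_pow block_restrict neg_pair_def) (simp add: block_def)
  have "y \<in> pair_prod n (\<lambda>j. neg_pair ` N j) \<longleftrightarrow> (\<exists>x\<in>pair_prod n N. y = inv\<^bsub>Z4_pow (2 * n)\<^esub> x)" for y
  proof
    assume y: "y \<in> pair_prod n (\<lambda>j. neg_pair ` N j)"
    then have yc: "y \<in> carrier (Z4_pow (2 * n))"
      by (simp add: pair_prod_iff)
    have "neg_pair (block y j) \<in> N j" if j: "j < n" for j
    proof -
      obtain p where p: "p \<in> N j" "block y j = neg_pair p"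
        using y j by (auto simp: pair_prod_iff)
      then have "p \<in> Z4_sq"
        using assms[OF j] by blast
      then show ?thesis
        using p by (simp add: neg_neg_pair)
    qed
    then have "inv\<^bsub>Z4_pow (2 * n)\<^esub> y \<in> pair_prod n N"
      using yc bl by (simp add: pair_prod_iff)
    then show "\<exists>x\<in>pair_prod n N. y = inv\<^bsub>Z4_pow (2 * n)\<^esub> x"
      using yc by (metis G.inv_inv)
  next
    assume "\<exists>x\<in>pair_prod n N. y = inv\<^bsub>Z4_pow (2 * n)\<^esub> x"
    then show "y \<in> pair_prod n (\<lambda>j. neg_pair ` N j)"
      using bl by (auto simp: pair_prod_iff)
  qed
  then show ?thesis
    unfolding SET_INV_def by blast
qed

lemma block_concat_vec:
  assumes "j < m1 + m2"
  shows "block (concat_vec (2 * m1) (2 * m2) x1 x2) j = (if j < m1 then block x1 j else block x2 (j - m1))"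
proof -
  have "2 * j - 2 * m1 = 2 * (j - m1)"
    by simp
  moreover have "2 * j + 1 - 2 * m1 = 2 * (j - m1) + 1" if "\<not> j < m1"
    using that by simp
  ultimately show ?thesis
    using assms by (auto simp: block_def concat_vec_def)
qed

lemma concat_vec_extensional: "concat_vec (2 * m1) (2 * m2) x1 x2 \<in> extensional {..<2 * (m1 + m2)}"
  by (simp add: concat_vec_def distrib_left)

lemma concat_vec_pair_prod:
  "{concat_vec (2 * m1) (2 * m2) x1 x2 | x1 x2. x1 \<in> pair_prod m1 N1 \<and> x2 \<in> pair_prod m2 N2}
     = pair_prod (m1 + m2) (\<lambda>j. if j < m1 then N1 j else N2 (j - m1))" (is "?C = ?P")
proof (intro equalityI subsetI)
  fix x assume "x \<in> ?C"
  then obtain x1 x2 where x: "x = concat_vec (2 * m1) (2 * m2) x1 x2"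
    and x1: "x1 \<in> pair_prod m1 N1" and x2: "x2 \<in> pair_prod m2 N2"
    by blast
  have "block x j \<in> Z4_sq \<and> block x j \<in> (if j < m1 then N1 j else N2 (j - m1))" if "j < m1 + m2" for j
    using x1 x2 that unfolding x block_concat_vec[OF that]
    by (auto simp: pair_prod_iff carrier_Z4_pow_iff)
  moreover have "x \<in> extensional {..<2 * (m1 + m2)}"
    unfolding x by (rule concat_vec_extensional)
  ultimately show "x \<in> ?P"
    unfolding pair_prod_iff carrier_Z4_pow_iff by blast
next
  fix x assume x: "x \<in> ?P"
  define x1 where "x1 = (\<lambda>i\<in>{..<2 * m1}. x i)"
  define x2 where "x2 = (\<lambda>i\<in>{..<2 * m2}. x (2 * m1 + i))"
  have b1: "block x1 j = block x j" if "j < m1" for j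
    using that by (simp add: x1_def block_def)
  have b2: "block x2 j = block x (m1 + j)" if "j < m2" for j
    using that by (simp add: x2_def block_def distrib_left)
  have xb: "block x j \<in> Z4_sq \<and> block x j \<in> (if j < m1 then N1 j else N2 (j - m1))" if "j < m1 + m2" for j
    using x that block_in_Z4_sq unfolding pair_prod_iff by blast
  have "x1 \<in> extensional {..<2 * m1}"
    by (simp add: x1_def)
  then have "x1 \<in> pair_prod m1 N1"
    unfolding pair_prod_iff carrier_Z4_pow_iff using xb b1 by (metis trans_less_add1)
  moreover have "x2 \<in> pair_prod m2 N2"
  proof -
    have "block x2 j \<in> Z4_sq \<and> block x2 j \<in> N2 j" if "j < m2" for j
      using xb[of "m1 + j"] b2[OF that] that by simp
    moreover have "x2 \<in> extensional {..<2 * m2}"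
      by (simp add: x2_def)
    ultimately show ?thesis
      by (simp add: pair_prod_iff carrier_Z4_pow_iff)
  qed
  moreover have "x = concat_vec (2 * m1) (2 * m2) x1 x2"
  proof (rule block_ext)
    show "x \<in> extensional {..<2 * (m1 + m2)}"
      using x unfolding pair_prod_iff carrier_Z4_pow_iff by blast
    show "block x j = block (concat_vec (2 * m1) (2 * m2) x1 x2) j" if "j < m1 + m2" for j
      using b1[of j] b2[of "j - m1"] that by (auto simp: block_concat_vec)
  qed (rule concat_vec_extensional)
  ultimately show "x \<in> ?C"
    by blast
qed

section \<open>The two subsets as products\<close>

text \<open>The factors of \<open>T\<^sub>1 \<times> T\<^sub>2\<close>, the first \<open>m\<^sub>1\<close> of which belong to \<open>T\<^sub>1\<close>.\<close>

definition planar_factor :: "nat \<Rightarrow> nat \<Rightarrow> (int \<times> int) set" where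
  "planar_factor m1 j = (if j < m1 then J \<times> J else L)"

text \<open>The factors of \<open>T\<close> for \<open>u = 0\<close> and of \<open>-T\<close> for \<open>u \<noteq> 0\<close>, where \<open>T = T\<^sub>1 \<times> T\<^sub>2\<close>.\<close>

definition signed_factor :: "nat \<Rightarrow> int \<Rightarrow> nat \<Rightarrow> (int \<times> int) set" where
  "signed_factor m1 u j = (if u = 0 then planar_factor m1 j else neg_pair ` planar_factor m1 j)"

lemma J_sq_subset: "J \<times> J \<subseteq> Z4_sq"
  by (auto simp: J_def)

lemma L_subset: "L \<subseteq> Z4_sq"
  by (auto simp: L_def)

lemma factor_subset: "planar_factor m1 j \<subseteq> Z4_sq"
  using J_sq_subset L_subset by (simp add: planar_factor_def)

lemma signed_factor_subset: "signed_factor m1 u j \<subseteq> Z4_sq"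
  unfolding signed_factor_def using factor_subset neg_pair_in_Z4_sq by (metis image_subsetI)

lemma S1_eq_pair_prod: "S1 m1 = pair_prod m1 (\<lambda>_. J \<times> J)"
proof -
  have "x \<in> S1 m1 \<longleftrightarrow> x \<in> extensional {..<2 * m1} \<and> (\<forall>j<m1. block x j \<in> J \<times> J)" for x
  proof -
    have "x \<in> S1 m1 \<longleftrightarrow> x \<in> extensional {..<2 * m1} \<and> (\<forall>k<2 * m1. x k \<in> J)"
      unfolding S1_def PiE_iff by blast
    then show ?thesis
      unfolding all_less_double block_def by simp
  qed
  moreover have "x \<in> pair_prod m1 (\<lambda>_. J \<times> J) \<longleftrightarrow> x \<in> extensional {..<2 * m1} \<and> (\<forall>j<m1. block x j \<in> J \<times> J)" for x
    unfolding pair_prod_iff carrier_Z4_pow_iff using J_sq_subset by blast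
  ultimately show ?thesis
    by blast
qed

lemma T'_eq: "T' m1 m2 = {(u, x). u \<in> {0, 1} \<and> x \<in> pair_prod (m1 + m2) (signed_factor m1 u)}"
proof -
  let ?A = "{concat_vec (2 * m1) (2 * m2) x1 x2 | x1 x2. x1 \<in> T1 m1 \<and> x2 \<in> T2 m2}"
  let ?B = "{concat_vec (2 * m1) (2 * m2) x1 x2 | x1 x2.
        x1 \<in> set_inv\<^bsub>Z4_pow (2 * m1)\<^esub> (T1 m1) \<and> x2 \<in> set_inv\<^bsub>Z4_pow (2 * m2)\<^esub> (T2 m2)}"
  have 0: "?A = pair_prod (m1 + m2) (signed_factor m1 0)"
    unfolding S1_eq_pair_prod S2_def concat_vec_pair_prod
    by (rule pair_prod_cong) (simp add: signed_factor_def planar_factor_def)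
  have 1: "?B = pair_prod (m1 + m2) (signed_factor m1 1)"
    unfolding S1_eq_pair_prod S2_def set_inv_pair_prod[OF J_sq_subset] set_inv_pair_prod[OF L_subset]
      concat_vec_pair_prod
    by (rule pair_prod_cong) (simp add: signed_factor_def planar_factor_def)
  have "T' m1 m2 = {0} \<times> ?A \<union> {1} \<times> ?B"
    unfolding T'_def by blast
  then show ?thesis
    unfolding 0 1 by auto
qed

text \<open>The indicator of \<open>k mod 4 \<in> {0, 1}\<close> with values \<open>1\<close> and \<open>-1\<close>, as a combination of the
  characters \<open>\<i>\<^sup>k\<close> and \<open>(-\<i>)\<^sup>k\<close>.\<close>

lemma Re_one_minus_i_power: "Re ((1 - \<i>) * \<i> ^ k) = (if k mod 4 \<in> {0, 1} then 1 else - 1)"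
proof -
  have "\<i> ^ k = (\<i> ^ 4) ^ (k div 4) * \<i> ^ (k mod 4)"
    by (metis mult_div_mod_eq power_add power_mult)
  then have "\<i> ^ k = \<i> ^ (k mod 4)"
    by simp
  moreover have "k mod 4 = 0 \<or> k mod 4 = 1 \<or> k mod 4 = 2 \<or> k mod 4 = 3"
    by presburger
  ultimately show ?thesis
    by (auto simp: power3_eq_cube)
qed

text \<open>\<open>J_sign\<close> is \<open>1\<close> on \<open>S\<^sub>1\<^sub>0\<close> and \<open>-1\<close> on \<open>S\<^sub>1\<^sub>1\<close>; \<open>L_sign\<close> is \<open>1\<close> on \<open>S\<^sub>2\<^sub>0\<close> and \<open>-1\<close> on \<open>S\<^sub>2\<^sub>1\<close>.\<close>

definition J_sign :: "nat \<Rightarrow> (nat \<Rightarrow> int) \<Rightarrow> real" where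
  "J_sign n x = Re ((1 - \<i>) * (\<Prod>j<n. \<i> ^ nat (fst (block x j) + snd (block x j))))"

definition L_sign :: "nat \<Rightarrow> (nat \<Rightarrow> int) \<Rightarrow> real" where
  "L_sign n x = (\<Prod>j<n. if block x j = (3, 3) then - 1 else 1)"

lemma S1_iff: "x \<in> S1 n \<longleftrightarrow> x \<in> carrier (Z4_pow (2 * n)) \<and> (\<forall>k<2 * n. x k = 0 \<or> x k = 1)"
proof -
  have "y \<in> {0..<4}" if "y = 0 \<or> y = 1" for y :: int
    using that by auto
  then show ?thesis
    unfolding S1_def J_def carrier_Z4_pow PiE_iff by blast
qed

lemma B_eq:
  assumes "i \<le> 2 * n"
  shows "B n i = {x \<in> S1 n. (\<Sum>k<2 * n. nat (x k)) = i}"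
proof -
  have "card {k \<in> {..<2 * n}. x k = 0} = 2 * n - i \<and> card {k \<in> {..<2 * n}. x k = 1} = i
     \<longleftrightarrow> (\<forall>k<2 * n. x k = 0 \<or> x k = 1) \<and> (\<Sum>k<2 * n. nat (x k)) = i" for x :: "nat \<Rightarrow> int"
  proof -
    let ?Z = "{k \<in> {..<2 * n}. x k = 0}" and ?O = "{k \<in> {..<2 * n}. x k = 1}"
    have un: "card (?Z \<union> ?O) = card ?Z + card ?O"
      by (rule card_Un_disjoint) auto
    have full: "(\<forall>k<2 * n. x k = 0 \<or> x k = 1) \<longleftrightarrow> card ?Z + card ?O = 2 * n"
    proof
      assume "\<forall>k<2 * n. x k = 0 \<or> x k = 1"
      then have "?Z \<union> ?O = {..<2 * n}"
        by auto
      then show "card ?Z + card ?O = 2 * n"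
        using un by simp
    next
      assume "card ?Z + card ?O = 2 * n"
      then have "?Z \<union> ?O = {..<2 * n}"
        using un by (intro card_subset_eq) auto
      then show "\<forall>k<2 * n. x k = 0 \<or> x k = 1"
        by auto
    qed
    have "(\<Sum>k<2 * n. nat (x k)) = card ?O" if "\<forall>k<2 * n. x k = 0 \<or> x k = 1"
    proof -
      have "(\<Sum>k<2 * n. nat (x k)) = (\<Sum>k<2 * n. if x k = 1 then 1 else 0)"
        using that by (intro sum.cong) auto
      also have "\<dots> = card ?O"
        by (simp add: sum.If_cases Int_def)
      finally show ?thesis .
    qed
    then show ?thesis
      using full assms by auto
  qed
  then show ?thesis
    by (auto simp: B_def S1_iff)
qed

lemma J_sign_eq:
  assumes "x \<in> S1 n"
  shows "J_sign n x = (if (\<Sum>k<2 * n. nat (x k)) mod 4 \<in> {0, 1} then 1 else - 1)"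
proof -
  have "\<forall>k<2 * n. 0 \<le> x k"
    using assms by (force simp: S1_iff)
  then have nn: "\<forall>j<n. 0 \<le> x (2 * j) \<and> 0 \<le> x (2 * j + 1)"
    unfolding all_less_double .
  have "(\<Prod>j<n. \<i> ^ nat (fst (block x j) + snd (block x j)))
      = (\<Prod>j<n. \<i> ^ (nat (x (2 * j)) + nat (x (2 * j + 1))))"
    using nn by (intro prod.cong) (auto simp: block_def nat_add_distrib)
  also have "\<dots> = \<i> ^ (\<Sum>k<2 * n. nat (x k))"
    by (simp add: sum_double power_sum)
  finally show ?thesis
    unfolding J_sign_def by (simp only: Re_one_minus_i_power)
qed

lemma S1_sum_le:
  assumes "x \<in> S1 n"
  shows "(\<Sum>k<2 * n. nat (x k)) \<le> 2 * n"
proof -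
  have "nat (x k) \<le> 1" if "k \<in> {..<2 * n}" for k
    using assms that by (fastforce simp: S1_iff)
  then have "(\<Sum>k<2 * n. nat (x k)) \<le> of_nat (card {..<2 * n}) * 1"
    by (rule sum_bounded_above)
  then show ?thesis
    by simp
qed

lemma UN_B_mod_4:
  "(\<Union>i\<in>{i. i \<le> 2 * n \<and> i mod 4 \<in> R}. B n i) = {x \<in> S1 n. (\<Sum>k<2 * n. nat (x k)) mod 4 \<in> R}"
proof -
  have "x \<in> (\<Union>i\<in>{i. i \<le> 2 * n \<and> i mod 4 \<in> R}. B n i) \<longleftrightarrow>
      (\<exists>i. i \<le> 2 * n \<and> i mod 4 \<in> R \<and> x \<in> S1 n \<and> (\<Sum>k<2 * n. nat (x k)) = i)" for x
    using B_eq by blast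
  then show ?thesis
    using S1_sum_le by blast
qed

lemma S10_eq: "S10 n = {x \<in> S1 n. J_sign n x = 1}"
proof -
  have "J_sign n x = 1 \<longleftrightarrow> (\<Sum>k<2 * n. nat (x k)) mod 4 \<in> {0, 1}" if "x \<in> S1 n" for x
    unfolding J_sign_eq[OF that] by argo
  then show ?thesis
    unfolding S10_def UN_B_mod_4 by (intro Collect_cong conj_cong refl) simp
qed

lemma S11_eq: "S11 n = {x \<in> S1 n. J_sign n x = - 1}"
proof -
  have mod4: "k mod 4 \<in> {2, 3} \<longleftrightarrow> k mod 4 \<notin> {0, 1}" for k :: nat
    by auto
  have "J_sign n x = - 1 \<longleftrightarrow> (\<Sum>k<2 * n. nat (x k)) mod 4 \<in> {2, 3}" if "x \<in> S1 n" for x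
    unfolding J_sign_eq[OF that] mod4 by argo
  then show ?thesis
    unfolding S11_def UN_B_mod_4 by (intro Collect_cong conj_cong refl) simp
qed

lemma J_sign_cases: "x \<in> S1 n \<Longrightarrow> J_sign n x = 1 \<or> J_sign n x = - 1"
  by (simp add: J_sign_eq)

lemma L_sign_eq: "L_sign n x = (- 1) ^ card {j \<in> {..<n}. block x j = (3, 3)}"
  by (simp add: L_sign_def prod.If_cases Int_def)

lemma L_sign_cases: "L_sign n x = 1 \<or> L_sign n x = - 1"
  by (cases "even (card {j \<in> {..<n}. block x j = (3, 3)})") (simp_all add: L_sign_eq)

lemma E_eq: "E n i = {x \<in> S2 n. card {j \<in> {..<n}. block x j \<noteq> (3, 3)} = i}"
proof (intro equalityI subsetI)
  fix x assume "x \<in> E n i"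
  then obtain N where N: "\<forall>j<n. N j \<in> {L1, L2}" "card {j \<in> {..<n}. N j = L1} = i"
    and x: "x \<in> pair_prod n N"
    by (auto simp: E_def)
  have iff: "N j = L1 \<longleftrightarrow> block x j \<noteq> (3, 3)" if "j < n" for j
  proof -
    have "block x j \<in> N j" "N j = L1 \<or> N j = L2"
      using N x that by (auto simp: pair_prod_iff)
    then show ?thesis
      by (auto simp: L1_def L2_def)
  qed
  then have "{j \<in> {..<n}. N j = L1} = {j \<in> {..<n}. block x j \<noteq> (3, 3)}"
    by auto
  moreover have "x \<in> S2 n"
  proof -
    have "N j \<subseteq> L" if "j < n" for j
      using N that by (auto simp: L_def L1_def L2_def)
    then show ?thesis
      using x by (auto simp: S2_def pair_prod_iff)
  qed
  ultimately show "x \<in> {x \<in> S2 n. card {j \<in> {..<n}. block x j \<noteq> (3, 3)} = i}"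
    using N by simp
next
  fix x assume x: "x \<in> {x \<in> S2 n. card {j \<in> {..<n}. block x j \<noteq> (3, 3)} = i}"
  define N where "N j = (if block x j = (3, 3) then L2 else L1)" for j
  have "(3, 3) \<in> L2" "(3, 3) \<notin> L1"
    by (auto simp: L1_def L2_def)
  then have "L1 \<noteq> L2"
    by blast
  then have 1: "{j \<in> {..<n}. N j = L1} = {j \<in> {..<n}. block x j \<noteq> (3, 3)}"
    and 2: "{j \<in> {..<n}. N j = L2} = {..<n} - {j \<in> {..<n}. block x j \<noteq> (3, 3)}"
    by (auto simp: N_def)
  have "card {j \<in> {..<n}. N j = L2} = n - i"
    unfolding 2 using x by (subst card_Diff_subset) auto
  moreover have "x \<in> pair_prod n N"
    using x by (auto simp: S2_def pair_prod_iff N_def L_def L1_def L2_def)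
  moreover have "\<forall>j<n. N j \<in> {L1, L2}"
    by (simp add: N_def)
  ultimately show "x \<in> E n i"
    using x 1 unfolding E_def
    by (intro UnionI[of "pair_prod n N"] CollectI exI[of _ N] conjI) simp_all
qed

lemma card_not_33: "card {j \<in> {..<n}. block x j \<noteq> (3, 3)} + card {j \<in> {..<n}. block x j = (3, 3)} = n"
proof -
  have "card ({j \<in> {..<n}. block x j \<noteq> (3, 3)} \<union> {j \<in> {..<n}. block x j = (3, 3)})
      = card {j \<in> {..<n}. block x j \<noteq> (3, 3)} + card {j \<in> {..<n}. block x j = (3, 3)}"
    by (rule card_Un_disjoint) auto
  moreover have "{j \<in> {..<n}. block x j \<noteq> (3, 3)} \<union> {j \<in> {..<n}. block x j = (3, 3)} = {..<n}"
    by auto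
  ultimately show ?thesis
    by simp
qed

lemma UN_E_even:
  assumes "n \<le> 2 * k + 1"
  shows "(\<Union>i\<in>{0..k}. E n (2 * i)) = {x \<in> S2 n. even (card {j \<in> {..<n}. block x j \<noteq> (3, 3)})}"
proof -
  have "i \<in> {0..k}" if "card {j \<in> {..<n}. block x j \<noteq> (3, 3)} = 2 * i" for x i
    using card_not_33[of n x] assms that by simp
  then show ?thesis
    unfolding E_eq by (fastforce elim!: evenE)
qed

lemma UN_E_odd:
  assumes "n \<le> 2 * k"
  shows "(\<Union>i\<in>{0..<k}. E n (2 * i + 1)) = {x \<in> S2 n. odd (card {j \<in> {..<n}. block x j \<noteq> (3, 3)})}"
proof -
  have "i \<in> {0..<k}" if "card {j \<in> {..<n}. block x j \<noteq> (3, 3)} = 2 * i + 1" for x i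
    using card_not_33[of n x] assms that by simp
  then show ?thesis
    unfolding E_eq by (fastforce elim!: oddE)
qed

text \<open>\<open>L_sign\<close> is the parity of the number of factors \<open>L\<^sub>2\<close>, whereas \<open>S\<^sub>2\<^sub>0\<close> and \<open>S\<^sub>2\<^sub>1\<close> are defined by the parity
  of the number of factors \<open>L\<^sub>1\<close>. Passing from one to the other explains the case distinction
  on the parity of \<open>n\<close>.\<close>

lemma L_sign_1_iff: "L_sign n x = 1 \<longleftrightarrow> (even (card {j \<in> {..<n}. block x j \<noteq> (3, 3)}) \<longleftrightarrow> even n)"
proof -
  have "(- 1 :: real) ^ b = 1 \<longleftrightarrow> (even a \<longleftrightarrow> even n)" if "a + b = n" for a b :: nat
    using that by (cases "even b") auto
  from this[OF card_not_33] show ?thesis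
    by (simp only: L_sign_eq)
qed

lemma S20_eq: "S20 n = {x \<in> S2 n. L_sign n x = 1}"
proof (cases "odd n")
  case True
  then have "{0..(n - 1) div 2} = {0..<(n + 1) div 2}" "n \<le> 2 * ((n + 1) div 2)"
    by (auto elim!: oddE)
  then have "S20 n = {x \<in> S2 n. odd (card {j \<in> {..<n}. block x j \<noteq> (3, 3)})}"
    using True UN_E_odd[of n "(n + 1) div 2"] by (simp add: S20_def)
  then show ?thesis
    using True by (simp only: L_sign_1_iff) simp
next
  case False
  have "n \<le> 2 * (n div 2) + 1"
    by linarith
  then have "S20 n = {x \<in> S2 n. even (card {j \<in> {..<n}. block x j \<noteq> (3, 3)})}"
    using False UN_E_even[of n "n div 2"] by (simp add: S20_def)
  then show ?thesis
    using False by (simp only: L_sign_1_iff) simp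
qed

lemma S21_eq: "S21 n = {x \<in> S2 n. L_sign n x = - 1}"
proof -
  have "L_sign n x = - 1 \<longleftrightarrow> L_sign n x \<noteq> 1" for x
    using L_sign_cases[of n x] by auto
  moreover have "S21 n = {x \<in> S2 n. L_sign n x \<noteq> 1}"
  proof (cases "odd n")
    case True
    then have "n \<le> 2 * ((n - 1) div 2) + 1"
      by (auto elim!: oddE)
    then have "S21 n = {x \<in> S2 n. even (card {j \<in> {..<n}. block x j \<noteq> (3, 3)})}"
      using True UN_E_even[of n "(n - 1) div 2"] by (simp add: S21_def)
    then show ?thesis
      using True by (simp only: L_sign_1_iff) simp
  next
    case False
    then have "n \<le> 2 * (n div 2)"
      by simp
    then have "S21 n = {x \<in> S2 n. odd (card {j \<in> {..<n}. block x j \<noteq> (3, 3)})}"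
      using False UN_E_odd[of n "n div 2"] by (simp add: S21_def)
    then show ?thesis
      using False by (simp only: L_sign_1_iff) simp
  qed
  ultimately show ?thesis
    by simp
qed

lemma S1_partition: "S10 n \<union> S11 n = S1 n" "S10 n \<inter> S11 n = {}"
  using J_sign_cases by (auto simp: S10_eq S11_eq)

lemma S2_partition: "S20 n \<union> S21 n = S2 n" "S20 n \<inter> S21 n = {}"
  using L_sign_cases by (auto simp: S20_eq S21_eq)

text \<open>The functions \<open>g\<^sub>j\<close> on the factors, and the sign \<open>(-1)\<^sup>\<epsilon>\<close> of the level \<open>\<epsilon>\<close> on which \<open>S'\<close> contains
  a given \<open>x \<in> S\<^sub>1 \<times> S\<^sub>2\<close>.\<close>

definition twist :: "nat \<Rightarrow> nat \<Rightarrow> int \<times> int \<Rightarrow> complex" where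
  "twist m1 j p = (if j < m1 then \<i> ^ nat (fst p + snd p) else if p = (3, 3) then - 1 else 1)"

definition level_sign :: "nat \<Rightarrow> nat \<Rightarrow> (nat \<Rightarrow> int) \<Rightarrow> real" where
  "level_sign m1 m x = Re ((1 - \<i>) * (\<Prod>j<m. twist m1 j (block x j)))"

lemma prod_lessThan_add: "(\<Prod>j<m1 + m2. f j) = (\<Prod>j<m1. f j) * (\<Prod>j<m2. f (m1 + j))"
  for f :: "nat \<Rightarrow> 'a :: comm_monoid_mult" and m1 m2 :: nat
  by (induction m2) (simp_all add: mult.assoc)

lemma level_sign_concat_vec:
  "level_sign m1 (m1 + m2) (concat_vec (2 * m1) (2 * m2) x1 x2) = J_sign m1 x1 * L_sign m2 x2"
proof -
  let ?x = "concat_vec (2 * m1) (2 * m2) x1 x2"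
  have "(\<Prod>j<m1. twist m1 j (block ?x j)) = (\<Prod>j<m1. \<i> ^ nat (fst (block x1 j) + snd (block x1 j)))"
    by (rule prod.cong) (auto simp: block_concat_vec twist_def)
  moreover have "(\<Prod>j<m2. twist m1 (m1 + j) (block ?x (m1 + j))) = complex_of_real (L_sign m2 x2)"
    unfolding L_sign_def of_real_prod
    by (rule prod.cong) (auto simp: block_concat_vec twist_def)
  ultimately have "(1 - \<i>) * (\<Prod>j<m1 + m2. twist m1 j (block ?x j))
      = complex_of_real (L_sign m2 x2) * ((1 - \<i>) * (\<Prod>j<m1. \<i> ^ nat (fst (block x1 j) + snd (block x1 j))))"
    by (simp only: prod_lessThan_add mult_ac)
  moreover have "Re (complex_of_real r * z) = Re z * r" for r z
    by simp
  ultimately show ?thesis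
    unfolding level_sign_def J_sign_def by (simp only:)
qed

lemma S1_times_S2_eq:
  "{concat_vec (2 * m1) (2 * m2) x1 x2 | x1 x2. x1 \<in> S1 m1 \<and> x2 \<in> S2 m2}
     = pair_prod (m1 + m2) (planar_factor m1)"
  unfolding S1_eq_pair_prod S2_def concat_vec_pair_prod
  by (rule pair_prod_cong) (simp add: planar_factor_def)

lemma level_sign_cases:
  assumes "x \<in> pair_prod (m1 + m2) (planar_factor m1)"
  shows "level_sign m1 (m1 + m2) x = 1 \<or> level_sign m1 (m1 + m2) x = - 1"
proof -
  obtain x1 x2 where "x = concat_vec (2 * m1) (2 * m2) x1 x2" "x1 \<in> S1 m1" "x2 \<in> S2 m2"
    using assms unfolding S1_times_S2_eq[symmetric] by blast
  then show ?thesis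
    using J_sign_cases[of x1 m1] L_sign_cases[of m2 x2] by (auto simp: level_sign_concat_vec)
qed

text \<open>\<open>S'\<close> is the graph of a function on \<open>S\<^sub>1 \<times> S\<^sub>2\<close>.\<close>

lemma S'_eq:
  "S' m1 m2 = (\<lambda>x. (if level_sign m1 (m1 + m2) x = 1 then 0 else 1, x)) ` pair_prod (m1 + m2) (planar_factor m1)"
proof -
  let ?c = "concat_vec (2 * m1) (2 * m2)"
  have 0: "(x1, x2) \<in> S0' m1 m2 \<longleftrightarrow> x1 \<in> S1 m1 \<and> x2 \<in> S2 m2 \<and> level_sign m1 (m1 + m2) (?c x1 x2) = 1" for x1 x2
    using J_sign_cases[of x1 m1] L_sign_cases[of m2 x2]
    by (auto simp: S0'_def S10_eq S11_eq S20_eq S21_eq level_sign_concat_vec)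
  have 1: "(x1, x2) \<in> S1' m1 m2 \<longleftrightarrow> x1 \<in> S1 m1 \<and> x2 \<in> S2 m2 \<and> level_sign m1 (m1 + m2) (?c x1 x2) \<noteq> 1" for x1 x2
    using J_sign_cases[of x1 m1] L_sign_cases[of m2 x2]
    by (auto simp: S1'_def S10_eq S11_eq S20_eq S21_eq level_sign_concat_vec)
  let ?A = "{?c x1 x2 | x1 x2. x1 \<in> S1 m1 \<and> x2 \<in> S2 m2}"
  let ?s = "level_sign m1 (m1 + m2)"
  have "S' m1 m2 = {0} \<times> {x \<in> ?A. ?s x = 1} \<union> {1} \<times> {x \<in> ?A. ?s x \<noteq> 1}"
    unfolding S'_def 0 1 by blast
  moreover have "{0} \<times> {x \<in> A. Q x} \<union> {1} \<times> {x \<in> A. \<not> Q x} = (\<lambda>x. (if Q x then 0 else 1 :: int, x)) ` A"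
    for A and Q :: "(nat \<Rightarrow> int) \<Rightarrow> bool"
    by (auto simp: image_iff split: if_splits)
  ultimately show ?thesis
    unfolding S1_times_S2_eq by simp
qed

section \<open>Sums and counts over a single factor\<close>

text \<open>The canonical characters of \<open>\<int>\<^sub>4\<^sup>2\<close>.\<close>

definition pair_char :: "int \<times> int \<Rightarrow> int \<times> int \<Rightarrow> complex" where
  "pair_char z p = \<i> powi (fst z * fst p + snd z * snd p)"

lemma planar_factor_cases: "planar_factor m1 j = J \<times> J \<and> j < m1 \<or> planar_factor m1 j = L \<and> \<not> j < m1"
  by (simp add: planar_factor_def)

lemma J_sq_eq: "J \<times> J = {(0, 0), (0, 1), (1, 0), (1, 1)}"
  by (auto simp: J_def)

lemma neg_J_sq_eq: "neg_pair ` (J \<times> J) = {(0, 0), (0, 3), (3, 0), (3, 3)}"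
  by (simp add: J_sq_eq neg_pair_def)

lemma neg_L_eq: "neg_pair ` L = {(0, 0), (0, 3), (3, 0), (1, 1)}"
  by (simp add: L_def neg_pair_def)

lemma Z4_sq_cases:
  assumes "z \<in> Z4_sq"
  obtains a b where "z = (a, b)" "a \<in> {0, 1, 2, 3}" "b \<in> {0, 1, 2, 3}"
proof -
  have "{0..<4} = {0, 1, 2, 3 :: int}"
    by auto
  then show ?thesis
    using assms that by blast
qed

lemma i_power_odd_numeral: "\<i> ^ numeral (Num.Bit1 k) = (- 1) ^ numeral k * \<i>"
proof -
  have "numeral (Num.Bit1 k) = Suc (2 * numeral k)"
    by simp
  then show ?thesis
    by (simp only: power_Suc2 power_mult power2_i)
qed

lemma pair_count_eq_sum: "finite A \<Longrightarrow> pair_count A C z = (\<Sum>p\<in>A. if diff_pair p z \<in> C then 1 else 0)"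
  by (simp add: pair_count_def sum.If_cases Int_def)

text \<open>The next two lemmas, together with \<open>cmod_twisted_sum\<close>, \<open>cmod_cnj_twisted_sum\<close> and
  \<open>twisted_sum_mult_cnj_Real\<close> below, are the planar identities on which the duality rests.
  They are checked for each value of \<open>z\<close>.\<close>

lemma planar_char_sum:
  assumes "z \<in> Z4_sq"
  shows "(cmod (\<Sum>p\<in>planar_factor m1 j. pair_char z p))\<^sup>2
           = 4 * real (pair_count (planar_factor m1 j) (planar_factor m1 j) z)"
  using assms
proof (rule Z4_sq_cases)
  fix a b :: int
  assume "z = (a, b)" "a \<in> {0, 1, 2, 3}" "b \<in> {0, 1, 2, 3}"
  then show ?thesis
    using planar_factor_cases[of m1 j]
    by (elim insertE emptyE disjE conjE; hypsubst)
      (simp_all add: J_sq_eq L_def pair_count_eq_sum diff_pair_def pair_char_def cmod_power2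
        i_power_odd_numeral)
qed

lemma pair_count_neg_neg:
  assumes "z \<in> Z4_sq"
  shows "pair_count (neg_pair ` planar_factor m1 j) (neg_pair ` planar_factor m1 j) z
           = pair_count (planar_factor m1 j) (planar_factor m1 j) z"
  using assms
proof (rule Z4_sq_cases)
  fix a b :: int
  assume "z = (a, b)" "a \<in> {0, 1, 2, 3}" "b \<in> {0, 1, 2, 3}"
  then show ?thesis
    using planar_factor_cases[of m1 j]
    by (elim insertE emptyE disjE conjE; hypsubst)
      (simp_all add: J_sq_eq L_def neg_pair_def pair_count_eq_sum diff_pair_def)
qed

lemma twist_J: "j < m1 \<Longrightarrow> twist m1 j (0, 0) = 1 \<and> twist m1 j (0, 1) = \<i>
    \<and> twist m1 j (1, 0) = \<i> \<and> twist m1 j (1, 1) = - 1"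
  by (simp add: twist_def)

lemma twist_L: "\<not> j < m1 \<Longrightarrow> twist m1 j (0, 0) = 1 \<and> twist m1 j (0, 1) = 1
    \<and> twist m1 j (1, 0) = 1 \<and> twist m1 j (3, 3) = - 1"
  by (simp add: twist_def)

lemma sum_J_sq: "(\<Sum>p\<in>J \<times> J. f p) = f (0, 0) + f (0, 1) + f (1, 0) + f (1, 1)"
  by (simp add: J_sq_eq add.assoc)

lemma sum_L: "(\<Sum>p\<in>L. f p) = f (0, 0) + f (0, 1) + f (1, 0) + f (3, 3)"
  by (simp add: L_def add.assoc)

text \<open>The sums of a planar character over a factor, twisted by \<open>g\<^sub>j\<close> and by its conjugate. On the
  factors \<open>L\<close> both agree, because there \<open>g\<^sub>j\<close> is real.\<close>

definition twisted_sum :: "nat \<Rightarrow> nat \<Rightarrow> int \<times> int \<Rightarrow> complex" where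
  "twisted_sum m1 j z = (\<Sum>p\<in>planar_factor m1 j. twist m1 j p * pair_char z p)"

definition cnj_twisted_sum :: "nat \<Rightarrow> nat \<Rightarrow> int \<times> int \<Rightarrow> complex" where
  "cnj_twisted_sum m1 j z = (\<Sum>p\<in>planar_factor m1 j. cnj (twist m1 j p) * pair_char z p)"

lemma twisted_sum_J:
  assumes "j < m1"
  shows "twisted_sum m1 j (a, b) = 1 + \<i> * \<i> powi b + \<i> * \<i> powi a - \<i> powi (a + b)"
    and "cnj_twisted_sum m1 j (a, b) = 1 - \<i> * \<i> powi b - \<i> * \<i> powi a - \<i> powi (a + b)"
  using assms twist_J[OF assms]
  by (simp_all add: twisted_sum_def cnj_twisted_sum_def planar_factor_def sum_J_sq pair_char_def)

lemma twisted_sum_L: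
  assumes "\<not> j < m1"
  shows "twisted_sum m1 j (a, b) = 1 + \<i> powi b + \<i> powi a - \<i> powi (a * 3 + b * 3)"
    and "cnj_twisted_sum m1 j (a, b) = 1 + \<i> powi b + \<i> powi a - \<i> powi (a * 3 + b * 3)"
  using assms twist_L[OF assms]
  by (simp_all add: twisted_sum_def cnj_twisted_sum_def planar_factor_def sum_L pair_char_def)

lemma cmod_twisted_sum:
  assumes "z \<in> Z4_sq"
  shows "(cmod (twisted_sum m1 j z))\<^sup>2 = 4 * real (pair_count (neg_pair ` planar_factor m1 j) (planar_factor m1 j) z)"
  using assms
proof (rule Z4_sq_cases)
  fix a b :: int
  assume "z = (a, b)" "a \<in> {0, 1, 2, 3}" "b \<in> {0, 1, 2, 3}"
  then show ?thesis
    using planar_factor_cases[of m1 j]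
    by (elim insertE emptyE disjE conjE; hypsubst)
      (simp_all add: twisted_sum_J twisted_sum_L J_sq_eq L_def neg_pair_def pair_count_eq_sum
        diff_pair_def cmod_power2 i_power_odd_numeral)
qed

lemma cmod_cnj_twisted_sum:
  assumes "z \<in> Z4_sq"
  shows "(cmod (cnj_twisted_sum m1 j z))\<^sup>2 = 4 * real (pair_count (planar_factor m1 j) (neg_pair ` planar_factor m1 j) z)"
  using assms
proof (rule Z4_sq_cases)
  fix a b :: int
  assume "z = (a, b)" "a \<in> {0, 1, 2, 3}" "b \<in> {0, 1, 2, 3}"
  then show ?thesis
    using planar_factor_cases[of m1 j]
    by (elim insertE emptyE disjE conjE; hypsubst)
      (simp_all add: twisted_sum_J twisted_sum_L J_sq_eq L_def neg_pair_def pair_count_eq_sum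
        diff_pair_def cmod_power2 i_power_odd_numeral)
qed

lemma twisted_sum_mult_cnj_Real:
  assumes "z \<in> Z4_sq"
  shows "twisted_sum m1 j z * cnj (cnj_twisted_sum m1 j z) \<in> \<real>"
proof (cases "j < m1")
  case True
  show ?thesis
    using assms
  proof (rule Z4_sq_cases)
    fix a b :: int
    assume "z = (a, b)" "a \<in> {0, 1, 2, 3}" "b \<in> {0, 1, 2, 3}"
    then show ?thesis
      by (elim insertE emptyE; hypsubst)
        (simp_all add: twisted_sum_J[OF True] complex_is_Real_iff i_power_odd_numeral)
  qed
next
  case False
  have "w * cnj w \<in> \<real>" for w
    by (simp add: complex_is_Real_iff)
  moreover have "cnj_twisted_sum m1 j z = twisted_sum m1 j z"
    using twisted_sum_L[OF False] by (cases z) simp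
  ultimately show ?thesis
    by simp
qed

lemma card_planar_factor: "card (planar_factor m1 j) = 4"
  by (simp add: planar_factor_def J_sq_eq L_def)

lemma card_signed_factor: "card (signed_factor m1 u j) = 4"
  by (simp add: signed_factor_def card_planar_factor)
    (simp add: planar_factor_def neg_J_sq_eq neg_L_eq)

text \<open>The set of differences \<open>p - q\<close> with \<open>p \<in> A\<close> and \<open>q \<in> C\<close>.\<close>

definition pair_support :: "(int \<times> int) set \<Rightarrow> (int \<times> int) set \<Rightarrow> (int \<times> int) set" where
  "pair_support A C = {z \<in> Z4_sq. pair_count A C z \<noteq> 0}"

lemma pair_support_subset: "pair_support A C \<subseteq> Z4_sq"
  by (auto simp: pair_support_def)

lemma pair_count_nonzero_iff: "finite A \<Longrightarrow> pair_count A C z \<noteq> 0 \<longleftrightarrow> (\<exists>p\<in>A. diff_pair p z \<in> C)"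
  by (auto simp: pair_count_def)

lemma Z4_sq_eq: "Z4_sq = set (List.product [0, 1, 2, 3] [0, 1, 2, 3])"
proof -
  have "{0..<4} = {0, 1, 2, 3 :: int}"
    by auto
  then show ?thesis
    by auto
qed

lemma Collect_mem_set_eq: "{z \<in> set xs. Q z} = set (filter Q xs)"
  by auto

lemma pair_support_eq:
  "finite A \<Longrightarrow> pair_support A C = set (filter (\<lambda>z. \<exists>p\<in>A. diff_pair p z \<in> C) (List.product [0, 1, 2, 3] [0, 1, 2, 3]))"
  unfolding pair_support_def Z4_sq_eq Collect_mem_set_eq[symmetric] by (simp only: pair_count_nonzero_iff)

lemma card_pair_support_J:
  "card (pair_support (J \<times> J) (J \<times> J)) = 9"
  "card (pair_support (J \<times> J) (neg_pair ` (J \<times> J))) = 9"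
  "card (pair_support (neg_pair ` (J \<times> J)) (J \<times> J)) = 9"
  "card (pair_support (J \<times> J) (neg_pair ` (J \<times> J)) \<inter> pair_support (neg_pair ` (J \<times> J)) (J \<times> J)) = 4"
  by (simp_all add: pair_support_eq J_sq_eq neg_pair_def diff_pair_def)

lemma card_pair_support_L:
  "card (pair_support L L) = 13"
  "card (pair_support L (neg_pair ` L)) = 10"
  "card (pair_support (neg_pair ` L) L) = 10"
  "card (pair_support L (neg_pair ` L) \<inter> pair_support (neg_pair ` L) L) = 10"
  by (simp_all add: pair_support_eq L_def neg_pair_def diff_pair_def)

text \<open>This excludes nonzero stabilizers: no nonzero \<open>p\<close> in a factor or its negative has \<open>2p\<close> in the
  factor.\<close>

lemma double_in_planar_factor:
  assumes "p \<in> signed_factor m1 u j" "((fst p + fst p) mod 4, (snd p + snd p) mod 4) \<in> planar_factor m1 j"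
  shows "p = (0, 0)"
proof -
  have "p \<in> planar_factor m1 j \<or> p \<in> neg_pair ` planar_factor m1 j"
    using assms(1) by (auto simp: signed_factor_def split: if_splits)
  then show ?thesis
    using assms(2) planar_factor_cases[of m1 j]
    by (auto simp: J_sq_eq L_def neg_pair_def)
qed

section \<open>Counting differences in \<open>T'\<close>\<close>

text \<open>In a representation \<open>y = a\<^sub>1 - a\<^sub>2\<close> the element \<open>a\<^sub>2\<close> is determined by \<open>a\<^sub>1\<close>.\<close>

lemma diff_count_eq:
  assumes "group G" "A \<subseteq> carrier G" "y \<in> carrier G"
  shows "diff_count G A y = card {a \<in> A. inv\<^bsub>G\<^esub> y \<otimes>\<^bsub>G\<^esub> a \<in> A}"
proof -
  interpret group G by fact
  let ?f = "\<lambda>a. (a, inv\<^bsub>G\<^esub> y \<otimes>\<^bsub>G\<^esub> a)"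
  have iff: "y = a \<otimes>\<^bsub>G\<^esub> inv\<^bsub>G\<^esub> b \<longleftrightarrow> b = inv\<^bsub>G\<^esub> y \<otimes>\<^bsub>G\<^esub> a" if "a \<in> A" "b \<in> A" for a b
  proof -
    have "a \<in> carrier G" "b \<in> carrier G"
      using that assms(2) by auto
    then show ?thesis
      using assms(3) by (metis inv_closed inv_inv inv_solve_left inv_solve_right m_closed)
  qed
  have "{(a1, a2). (a1, a2) \<in> A \<times> A \<and> y = a1 \<otimes>\<^bsub>G\<^esub> inv\<^bsub>G\<^esub> a2}
      = ?f ` {a \<in> A. inv\<^bsub>G\<^esub> y \<otimes>\<^bsub>G\<^esub> a \<in> A}"
  proof (intro equalityI subsetI)
    fix p assume "p \<in> {(a1, a2). (a1, a2) \<in> A \<times> A \<and> y = a1 \<otimes>\<^bsub>G\<^esub> inv\<^bsub>G\<^esub> a2}"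
    then obtain a b where ab: "p = (a, b)" "a \<in> A" "b \<in> A" "y = a \<otimes>\<^bsub>G\<^esub> inv\<^bsub>G\<^esub> b"
      by blast
    then have "b = inv\<^bsub>G\<^esub> y \<otimes>\<^bsub>G\<^esub> a"
      using iff by blast
    then show "p \<in> ?f ` {a \<in> A. inv\<^bsub>G\<^esub> y \<otimes>\<^bsub>G\<^esub> a \<in> A}"
      using ab by blast
  next
    fix p assume "p \<in> ?f ` {a \<in> A. inv\<^bsub>G\<^esub> y \<otimes>\<^bsub>G\<^esub> a \<in> A}"
    then obtain a where "p = ?f a" "a \<in> A" "inv\<^bsub>G\<^esub> y \<otimes>\<^bsub>G\<^esub> a \<in> A"
      by blast
    then show "p \<in> {(a1, a2). (a1, a2) \<in> A \<times> A \<and> y = a1 \<otimes>\<^bsub>G\<^esub> inv\<^bsub>G\<^esub> a2}"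
      using iff by blast
  qed
  moreover have "inj_on ?f {a \<in> A. inv\<^bsub>G\<^esub> y \<otimes>\<^bsub>G\<^esub> a \<in> A}"
    by (rule inj_onI) simp
  ultimately show ?thesis
    unfolding diff_count_def by (simp only: card_image)
qed

lemma card_two_levels:
  fixes U V :: "'a set"
  assumes "finite U" "finite V"
  shows "card ({0 :: int} \<times> U \<union> {1} \<times> V) = card U + card V"
proof -
  have "({0 :: int} \<times> U) \<inter> ({1} \<times> V) = {}"
    by (simp add: Times_Int_Times)
  then have "card ({0 :: int} \<times> U \<union> {1} \<times> V) = card ({0 :: int} \<times> U) + card ({1 :: int} \<times> V)"
    by (intro card_Un_disjoint finite_cartesian_product assms finite.intros)
  then show ?thesis
    by (simp only: card_cartesian_product) simp
qed

lemma T'_eq_levels: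
  "T' m1 m2 = {0} \<times> pair_prod (m1 + m2) (signed_factor m1 0) \<union> {1} \<times> pair_prod (m1 + m2) (signed_factor m1 1)"
  unfolding T'_eq by blast

lemma T'_subset: "T' m1 m2 \<subseteq> carrier (Z2_Z4_pow (2 * (m1 + m2)))"
  unfolding T'_eq carrier_Z2_Z4_pow carrier_Z4_pow[symmetric] pair_prod_iff by blast

text \<open>For \<open>w = 1\<close> the two elements of a representation lie on different levels, so that one of them
  comes from \<open>T\<close> and the other one from \<open>-T\<close>.\<close>

lemma diff_count_T':
  assumes "(w, z) \<in> carrier (Z2_Z4_pow (2 * (m1 + m2)))"
  shows "diff_count (Z2_Z4_pow (2 * (m1 + m2))) (T' m1 m2) (w, z) =
    (\<Prod>j<m1 + m2. pair_count (signed_factor m1 0 j) (signed_factor m1 w j) (block z j)) +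
    (\<Prod>j<m1 + m2. pair_count (signed_factor m1 1 j) (signed_factor m1 (1 - w) j) (block z j))"
proof -
  let ?m = "m1 + m2" and ?G = "Z2_Z4_pow (2 * (m1 + m2))"
  let ?d = "\<lambda>x. \<lambda>i\<in>{..<2 * ?m}. (x i - z i) mod 4"
  let ?U = "\<lambda>u v. {x \<in> pair_prod ?m (signed_factor m1 u). ?d x \<in> pair_prod ?m (signed_factor m1 v)}"
  have w: "w = 0 \<or> w = 1"
    using assms by (auto simp: carrier_Z2_Z4_pow)
  have mem0: "inv\<^bsub>?G\<^esub> (w, z) \<otimes>\<^bsub>?G\<^esub> (0, x) \<in> T' m1 m2
      \<longleftrightarrow> ?d x \<in> pair_prod ?m (signed_factor m1 ((0 - w) mod 2))" for x
    using w unfolding inv_mult_Z2_Z4_pow[OF assms] T'_eq by auto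
  have mem1: "inv\<^bsub>?G\<^esub> (w, z) \<otimes>\<^bsub>?G\<^esub> (1, x) \<in> T' m1 m2
      \<longleftrightarrow> ?d x \<in> pair_prod ?m (signed_factor m1 ((1 - w) mod 2))" for x
    using w unfolding inv_mult_Z2_Z4_pow[OF assms] T'_eq by auto
  have sgn: "signed_factor m1 ((0 - w) mod 2) = signed_factor m1 w"
    "signed_factor m1 ((1 - w) mod 2) = signed_factor m1 (1 - w)"
    using w by auto
  have split: "{a \<in> T' m1 m2. Q a} = {0} \<times> {x \<in> pair_prod ?m (signed_factor m1 0). Q (0, x)}
      \<union> {1} \<times> {x \<in> pair_prod ?m (signed_factor m1 1). Q (1, x)}" for Q
    unfolding T'_eq_levels by auto
  have "{a \<in> T' m1 m2. inv\<^bsub>?G\<^esub> (w, z) \<otimes>\<^bsub>?G\<^esub> a \<in> T' m1 m2}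
      = {0} \<times> ?U 0 w \<union> {1} \<times> ?U 1 (1 - w)"
    unfolding split mem0 mem1 sgn by (rule refl)
  moreover have "card ({0 :: int} \<times> ?U 0 w \<union> {1} \<times> ?U 1 (1 - w)) = card (?U 0 w) + card (?U 1 (1 - w))"
    by (rule card_two_levels) (simp_all add: finite_pair_prod)
  ultimately show ?thesis
    using diff_count_eq[OF group_Z2_Z4_pow T'_subset assms]
    by (simp only: card_pair_prod_diff[OF signed_factor_subset])
qed

section \<open>Character sums over \<open>S'\<close>\<close>

lemma card_S': "card (S' m1 m2) = 4 ^ (m1 + m2)"
proof -
  have "card (S' m1 m2) = card (pair_prod (m1 + m2) (planar_factor m1))"
    unfolding S'_eq by (rule card_image) (simp add: inj_on_def)
  then show ?thesis
    by (simp add: card_pair_prod factor_subset card_planar_factor)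
qed

lemma card_T': "card (T' m1 m2) = 2 * 4 ^ (m1 + m2)"
  unfolding T'_eq_levels
  by (simp add: card_two_levels finite_pair_prod card_pair_prod signed_factor_subset card_signed_factor)

lemma S'_subset: "S' m1 m2 \<subseteq> carrier (Z2_Z4_pow (2 * (m1 + m2)))"
proof -
  have "(if b then 0 else 1, x) \<in> {0, 1 :: int} \<times> carrier (Z4_pow (2 * (m1 + m2)))"
    if "x \<in> pair_prod (m1 + m2) (planar_factor m1)" for x b
    using that unfolding pair_prod_iff by simp
  then show ?thesis
    unfolding S'_eq carrier_Z2_Z4_pow carrier_Z4_pow[symmetric] by blast
qed

lemma char_sum_S':
  assumes "w \<in> {0, 1}"
  shows "char_sum (canonical_iso (2 * (m1 + m2)) (w, z)) (S' m1 m2) =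
    (\<Sum>x\<in>pair_prod (m1 + m2) (planar_factor m1).
       (if w = 0 then 1 else complex_of_real (level_sign m1 (m1 + m2) x)) *
       (\<Prod>j<m1 + m2. pair_char (block z j) (block x j)))"
proof -
  let ?m = "m1 + m2"
  let ?P = "pair_prod ?m (planar_factor m1)"
  let ?f = "\<lambda>x. (if level_sign m1 ?m x = 1 then 0 else 1 :: int, x)"
  have inj: "inj_on ?f ?P"
    by (rule inj_onI) simp
  have "canonical_iso (2 * ?m) (w, z) (?f x) =
      (if w = 0 then 1 else complex_of_real (level_sign m1 ?m x)) *
      (\<Prod>j<?m. pair_char (block z j) (block x j))" if x: "x \<in> ?P" for x
  proof -
    have "?f x \<in> carrier (Z2_Z4_pow (2 * ?m))"
      using S'_subset x unfolding S'_eq by blast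
    then have "canonical_iso (2 * ?m) (w, z) (?f x) =
        (- 1) powi (w * (if level_sign m1 ?m x = 1 then 0 else 1)) * (\<Prod>k<2 * ?m. \<i> powi (z k * x k))"
      by (rule canonical_iso_apply)
    moreover have "(\<Prod>k<2 * ?m. \<i> powi (z k * x k)) = (\<Prod>j<?m. pair_char (block z j) (block x j))"
      unfolding prod_double by (simp add: pair_char_def block_def power_int_add)
    moreover have "(- 1) powi (w * (if level_sign m1 ?m x = 1 then 0 else 1)) =
        (if w = 0 then 1 else complex_of_real (level_sign m1 ?m x))"
      using assms level_sign_cases[OF x] by auto
    ultimately show ?thesis
      by simp
  qed
  then show ?thesis
    unfolding char_sum_def S'_eq sum.reindex[OF inj] by (simp add: o_def)
qed

lemma char_sum_S'_0:
  "char_sum (canonical_iso (2 * (m1 + m2)) (0, z)) (S' m1 m2) =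
    (\<Prod>j<m1 + m2. \<Sum>p\<in>planar_factor m1 j. pair_char (block z j) p)"
  using sum_pair_prod[of "m1 + m2" "planar_factor m1" "\<lambda>j. pair_char (block z j)"] factor_subset
  by (simp only: char_sum_S' insert_iff simp_thms if_True mult_1)

lemma char_sum_S'_1:
  "char_sum (canonical_iso (2 * (m1 + m2)) (1, z)) (S' m1 m2) =
    ((1 - \<i>) * (\<Prod>j<m1 + m2. twisted_sum m1 j (block z j)) +
     (1 + \<i>) * (\<Prod>j<m1 + m2. cnj_twisted_sum m1 j (block z j))) / 2"
proof -
  let ?m = "m1 + m2"
  let ?P = "pair_prod ?m (planar_factor m1)"
  let ?c = "\<lambda>x. \<Prod>j<?m. pair_char (block z j) (block x j)"
  let ?t = "\<lambda>x. \<Prod>j<?m. twist m1 j (block x j)"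
  have sign: "complex_of_real (level_sign m1 ?m x) = ((1 - \<i>) * ?t x + (1 + \<i>) * cnj (?t x)) / 2" for x
  proof -
    have "complex_of_real (Re v) = (v + cnj v) / 2" for v
      by (simp add: complex_eq_iff)
    moreover have "cnj ((1 - \<i>) * v) = (1 + \<i>) * cnj v" for v
      by simp
    ultimately show ?thesis
      unfolding level_sign_def by (simp only:)
  qed
  have "char_sum (canonical_iso (2 * ?m) (1, z)) (S' m1 m2) =
      (\<Sum>x\<in>?P. complex_of_real (level_sign m1 ?m x) * ?c x)"
    (* distrib_left_numeral would rewrite 2 * (m1 + m2), which the lemma needs in this form *)
    by (simp add: char_sum_S' del: distrib_left_numeral)
  also have "\<dots> = (\<Sum>x\<in>?P. (((1 - \<i>) * ?t x + (1 + \<i>) * cnj (?t x)) / 2) * ?c x)"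
    by (simp only: sign)
  also have "\<dots> = (\<Sum>x\<in>?P. ((1 - \<i>) * (?t x * ?c x) + (1 + \<i>) * (cnj (?t x) * ?c x)) / 2)"
    by (rule sum.cong) (simp_all only: times_divide_eq_left distrib_right mult.assoc)
  also have "\<dots> = ((1 - \<i>) * (\<Sum>x\<in>?P. ?t x * ?c x) + (1 + \<i>) * (\<Sum>x\<in>?P. cnj (?t x) * ?c x)) / 2"
    by (simp only: sum_divide_distrib[symmetric] sum.distrib sum_distrib_left[symmetric])
  also have "(\<Sum>x\<in>?P. ?t x * ?c x) = (\<Prod>j<?m. twisted_sum m1 j (block z j))"
    unfolding twisted_sum_def prod.distrib[symmetric]
    by (rule sum_pair_prod[where f = "\<lambda>j p. twist m1 j p * pair_char (block z j) p"]) (rule factor_subset)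
  also have "(\<Sum>x\<in>?P. cnj (?t x) * ?c x) = (\<Prod>j<?m. cnj_twisted_sum m1 j (block z j))"
    unfolding cnj_twisted_sum_def cnj_prod prod.distrib[symmetric]
    by (rule sum_pair_prod[where f = "\<lambda>j p. cnj (twist m1 j p) * pair_char (block z j) p"]) (rule factor_subset)
  finally show ?thesis .
qed

text \<open>The mixed term of the squared modulus is a multiple of \<open>Im (P * cnj Q)\<close>.\<close>

lemma cmod_mix:
  assumes "P * cnj Q \<in> \<real>"
  shows "(cmod (((1 - \<i>) * P + (1 + \<i>) * Q) / 2))\<^sup>2 = ((cmod P)\<^sup>2 + (cmod Q)\<^sup>2) / 2"
proof -
  have im: "Im P * Re Q = Re P * Im Q"
    using assms by (simp add: complex_is_Real_iff)
  have "(cmod (((1 - \<i>) * P + (1 + \<i>) * Q) / 2))\<^sup>2 =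
      ((Re P + Im P + (Re Q - Im Q)) / 2)\<^sup>2 + ((Im P - Re P + (Im Q + Re Q)) / 2)\<^sup>2"
    unfolding cmod_power2 by (simp add: algebra_simps)
  also have "\<dots> = ((Re P)\<^sup>2 + (Im P)\<^sup>2 + (Re Q)\<^sup>2 + (Im Q)\<^sup>2 + 2 * (Im P * Re Q - Re P * Im Q)) / 2"
    by (simp add: power2_eq_square field_simps)
  finally show ?thesis
    using im by (simp add: cmod_power2)
qed

lemma cmod_prod_power2: "(cmod (\<Prod>j\<in>A. f j))\<^sup>2 = (\<Prod>j\<in>A. (cmod (f j))\<^sup>2)"
  by (simp only: prod_norm[symmetric] prod_power_distrib)

lemma Reals_prod: "(\<And>j. j \<in> A \<Longrightarrow> f j \<in> \<real>) \<Longrightarrow> (\<Prod>j\<in>A. f j) \<in> (\<real> :: complex set)"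
  by (induction A rule: infinite_finite_induct) auto

lemma formally_dual_pair_S'_T':
  "formally_dual_pair (Z2_Z4_pow (2 * (m1 + m2))) (canonical_iso (2 * (m1 + m2))) (S' m1 m2) (T' m1 m2)"
proof -
  let ?m = "m1 + m2" and ?G = "Z2_Z4_pow (2 * (m1 + m2))"
  have "(cmod (char_sum (canonical_iso (2 * ?m) y) (S' m1 m2)))\<^sup>2
      = (real (card (S' m1 m2)))\<^sup>2 / real (card (T' m1 m2)) * real (diff_count ?G (T' m1 m2) y)"
    if "y \<in> carrier ?G" for y
  proof -
    obtain w z where y: "y = (w, z)"
      by (cases y)
    have w: "w = 0 \<or> w = 1" and "z \<in> carrier (Z4_pow (2 * ?m))"
      using that by (auto simp: y carrier_Z2_Z4_pow carrier_Z4_pow)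
    then have z: "block z j \<in> Z4_sq" if "j < ?m" for j
      using block_in_Z4_sq that by blast
    have ratio: "(real (card (S' m1 m2)))\<^sup>2 / real (card (T' m1 m2)) = 4 ^ ?m / 2"
      by (simp add: card_S' card_T' power2_eq_square)
    have pow: "(\<Prod>j<?m. 4 * real (c j)) = 4 ^ ?m * real (\<Prod>j<?m. c j)" for c :: "nat \<Rightarrow> nat"
      by (simp add: prod.distrib)
    show ?thesis
    proof (cases "w = 0")
      case True
      have "(cmod (char_sum (canonical_iso (2 * ?m) y) (S' m1 m2)))\<^sup>2
          = (\<Prod>j<?m. 4 * real (pair_count (planar_factor m1 j) (planar_factor m1 j) (block z j)))"
        unfolding y True char_sum_S'_0 cmod_prod_power2
        by (rule prod.cong) (simp_all add: planar_char_sum z)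
      moreover have "diff_count ?G (T' m1 m2) y
          = 2 * (\<Prod>j<?m. pair_count (planar_factor m1 j) (planar_factor m1 j) (block z j))"
      proof -
        have "(\<Prod>j<?m. pair_count (neg_pair ` planar_factor m1 j) (neg_pair ` planar_factor m1 j) (block z j))
            = (\<Prod>j<?m. pair_count (planar_factor m1 j) (planar_factor m1 j) (block z j))"
          by (rule prod.cong) (simp_all add: pair_count_neg_neg z)
        then show ?thesis
          using that unfolding y True by (simp add: diff_count_T' signed_factor_def del: distrib_left_numeral)
      qed
      ultimately show ?thesis
        unfolding ratio by (simp only: pow)
    next
      case False
      then have w1: "w = 1"
        using w by simp
      let ?P = "\<Prod>j<?m. twisted_sum m1 j (block z j)" and ?Q = "\<Prod>j<?m. cnj_twisted_sum m1 j (block z j)"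
      have "?P * cnj ?Q \<in> \<real>"
        unfolding cnj_prod prod.distrib[symmetric]
        by (rule Reals_prod) (simp add: twisted_sum_mult_cnj_Real z)
      then have "(cmod (char_sum (canonical_iso (2 * ?m) y) (S' m1 m2)))\<^sup>2 = ((cmod ?P)\<^sup>2 + (cmod ?Q)\<^sup>2) / 2"
        unfolding y w1 char_sum_S'_1 by (rule cmod_mix)
      moreover have "(cmod ?P)\<^sup>2
          = (\<Prod>j<?m. 4 * real (pair_count (neg_pair ` planar_factor m1 j) (planar_factor m1 j) (block z j)))"
        unfolding cmod_prod_power2 by (rule prod.cong) (simp_all add: cmod_twisted_sum z)
      moreover have "(cmod ?Q)\<^sup>2
          = (\<Prod>j<?m. 4 * real (pair_count (planar_factor m1 j) (neg_pair ` planar_factor m1 j) (block z j)))"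
        unfolding cmod_prod_power2 by (rule prod.cong) (simp_all add: cmod_cnj_twisted_sum z)
      moreover have "diff_count ?G (T' m1 m2) y
          = (\<Prod>j<?m. pair_count (planar_factor m1 j) (neg_pair ` planar_factor m1 j) (block z j)) +
            (\<Prod>j<?m. pair_count (neg_pair ` planar_factor m1 j) (planar_factor m1 j) (block z j))"
        using that unfolding y w1 by (simp add: diff_count_T' signed_factor_def del: distrib_left_numeral)
      ultimately show ?thesis
        unfolding ratio by (simp only: pow) (simp add: field_simps)
    qed
  qed
  moreover have "T' m1 m2 \<noteq> {}"
    using card_T'[of m1 m2] by auto
  ultimately show ?thesis
    unfolding formally_dual_pair_def
    using canonical_iso_is_iso S'_subset T'_subset by blast
qed

section \<open>Group elements that are not differences\<close>

lemma card_carrier_Z4_pow: "card (carrier (Z4_pow (2 * n))) = 16 ^ n"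
  by (simp add: carrier_Z4_pow card_PiE power_mult)

lemma card_pair_prod_support:
  assumes "\<And>j. N j \<subseteq> Z4_sq" "\<And>j. card (N j) = (if j < m1 then a else b)"
  shows "card (pair_prod (m1 + m2) N) = a ^ m1 * b ^ m2"
proof -
  have "(\<Prod>j<m1. card (N j)) = (\<Prod>j<m1. a)" "(\<Prod>j<m2. card (N (m1 + j))) = (\<Prod>j<m2. b)"
    by (rule prod.cong; simp add: assms(2))+
  then show ?thesis
    by (simp add: card_pair_prod[OF assms(1)] prod_lessThan_add)
qed

lemma prod_pair_count_nonzero_iff:
  assumes "z \<in> carrier (Z4_pow (2 * n))"
  shows "(\<Prod>j<n. pair_count (M j) (N j) (block z j)) \<noteq> 0 \<longleftrightarrow> z \<in> pair_prod n (\<lambda>j. pair_support (M j) (N j))"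
proof -
  have "(\<Prod>j<n. pair_count (M j) (N j) (block z j)) \<noteq> 0 \<longleftrightarrow> (\<forall>j<n. pair_count (M j) (N j) (block z j) \<noteq> 0)"
    by (simp add: prod_zero_iff Ball_def)
  then show ?thesis
    using assms block_in_Z4_sq[OF assms] unfolding pair_prod_iff pair_support_def by blast
qed

lemma theta_T':
  "int (theta (T' m1 m2) (Z2_Z4_pow (2 * (m1 + m2)))) =
    2 ^ (4 * (m1 + m2) + 1) - 3 ^ (2 * m1) * 13 ^ m2 - (2 * 3 ^ (2 * m1) - 2 ^ (2 * m1)) * 10 ^ m2"
proof -
  let ?m = "m1 + m2" and ?G = "Z2_Z4_pow (2 * (m1 + m2))"
  let ?Z = "carrier (Z4_pow (2 * ?m))"
  let ?F = "planar_factor m1" and ?N = "\<lambda>j. neg_pair ` planar_factor m1 j"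
  let ?A = "pair_prod ?m (\<lambda>j. pair_support (?F j) (?F j))"
  let ?B = "pair_prod ?m (\<lambda>j. pair_support (?F j) (?N j))"
  let ?C = "pair_prod ?m (\<lambda>j. pair_support (?N j) (?F j))"
  have zero: "diff_count ?G (T' m1 m2) (0, z) = 0 \<longleftrightarrow> z \<notin> ?A" if z: "z \<in> ?Z" for z
  proof -
    have "(0, z) \<in> carrier ?G"
      using z by (simp add: carrier_Z2_Z4_pow carrier_Z4_pow)
    moreover have "(\<Prod>j<?m. pair_count (?N j) (?N j) (block z j)) = (\<Prod>j<?m. pair_count (?F j) (?F j) (block z j))"
      by (rule prod.cong) (use block_in_Z4_sq[OF z] pair_count_neg_neg in auto)
    ultimately have "diff_count ?G (T' m1 m2) (0, z) = 2 * (\<Prod>j<?m. pair_count (?F j) (?F j) (block z j))"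
      by (simp add: diff_count_T' signed_factor_def del: distrib_left_numeral)
    then show ?thesis
      using prod_pair_count_nonzero_iff[OF z, of ?F ?F] by (metis mult_eq_0_iff zero_neq_numeral)
  qed
  have one: "diff_count ?G (T' m1 m2) (1, z) = 0 \<longleftrightarrow> z \<notin> ?B \<union> ?C" if z: "z \<in> ?Z" for z
  proof -
    have "(1, z) \<in> carrier ?G"
      using z by (simp add: carrier_Z2_Z4_pow carrier_Z4_pow)
    then have "diff_count ?G (T' m1 m2) (1, z) = (\<Prod>j<?m. pair_count (?F j) (?N j) (block z j))
        + (\<Prod>j<?m. pair_count (?N j) (?F j) (block z j))"
      by (simp add: diff_count_T' signed_factor_def del: distrib_left_numeral)
    then show ?thesis
      using prod_pair_count_nonzero_iff[OF z, of ?F ?N] prod_pair_count_nonzero_iff[OF z, of ?N ?F]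
      by (simp only: add_is_0 Un_iff) blast
  qed
  have sub: "?A \<subseteq> ?Z" "?B \<union> ?C \<subseteq> ?Z"
    by (auto simp: pair_prod_iff)
  have fin: "finite ?Z"
    by (simp add: carrier_Z4_pow finite_PiE)
  have "{g \<in> carrier ?G. diff_count ?G (T' m1 m2) g = 0} = {0} \<times> (?Z - ?A) \<union> {1} \<times> (?Z - (?B \<union> ?C))"
  proof -
    have "{g \<in> {0, 1} \<times> K. f g = 0} = {0} \<times> {z \<in> K. f (0, z) = 0} \<union> {1} \<times> {z \<in> K. f (1, z) = 0}"
      for K and f :: "int \<times> (nat \<Rightarrow> int) \<Rightarrow> nat"
      by auto
    moreover have "{z \<in> ?Z. diff_count ?G (T' m1 m2) (0, z) = 0} = ?Z - ?A"
      using zero by blast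
    moreover have "{z \<in> ?Z. diff_count ?G (T' m1 m2) (1, z) = 0} = ?Z - (?B \<union> ?C)"
      using one by blast
    ultimately show ?thesis
      unfolding carrier_Z2_Z4_pow carrier_Z4_pow[symmetric] by (simp only:)
  qed
  then have "theta (T' m1 m2) ?G = card (?Z - ?A) + card (?Z - (?B \<union> ?C))"
    unfolding theta_def by (simp only: card_two_levels finite_Diff fin)
  then have theta: "int (theta (T' m1 m2) ?G) = int (card (?Z - ?A)) + int (card (?Z - (?B \<union> ?C)))"
    by (simp only: of_nat_add)
  have compl: "int (card (?Z - K)) = 16 ^ ?m - int (card K)" if "K \<subseteq> ?Z" for K
  proof -
    have "card (?Z - K) = card ?Z - card K"
      using that finite_subset[OF that fin] by (rule card_Diff_subset[rotated])
    moreover have "card K \<le> card ?Z"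
      using fin that by (rule card_mono)
    ultimately show ?thesis
      unfolding card_carrier_Z4_pow by (simp add: of_nat_diff)
  qed
  have cA: "card ?A = 9 ^ m1 * 13 ^ m2"
    by (rule card_pair_prod_support[OF pair_support_subset])
      (simp add: planar_factor_def card_pair_support_J card_pair_support_L)
  have cB: "card ?B = 9 ^ m1 * 10 ^ m2"
    by (rule card_pair_prod_support[OF pair_support_subset])
      (simp add: planar_factor_def card_pair_support_J card_pair_support_L)
  have cC: "card ?C = 9 ^ m1 * 10 ^ m2"
    by (rule card_pair_prod_support[OF pair_support_subset])
      (simp add: planar_factor_def card_pair_support_J card_pair_support_L)
  have cBC: "card (?B \<inter> ?C) = 4 ^ m1 * 10 ^ m2"
    unfolding pair_prod_Int
    by (rule card_pair_prod_support[OF le_infI1[OF pair_support_subset]])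
      (simp add: planar_factor_def card_pair_support_J card_pair_support_L)
  have "card ?B + card ?C = card (?B \<union> ?C) + card (?B \<inter> ?C)"
    by (rule card_Un_Int) (rule finite_pair_prod)+
  then have "2 * (9 ^ m1 * 10 ^ m2) = card (?B \<union> ?C) + 4 ^ m1 * 10 ^ m2"
    unfolding cB cC cBC by (simp only: mult_2)
  then have "int (2 * (9 ^ m1 * 10 ^ m2)) = int (card (?B \<union> ?C) + 4 ^ m1 * 10 ^ m2)"
    by (simp only:)
  then have "int (card (?B \<union> ?C)) = 2 * (9 ^ m1 * 10 ^ m2) - 4 ^ m1 * 10 ^ m2"
    by simp
  then have "int (theta (T' m1 m2) ?G) = 2 * 16 ^ ?m - 9 ^ m1 * 13 ^ m2 - (2 * 9 ^ m1 - 4 ^ m1) * 10 ^ m2"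
    unfolding theta compl[OF sub(1)] compl[OF sub(2)] cA by (simp add: algebra_simps)
  moreover have "(2 :: int) ^ (4 * ?m + 1) = 2 * 16 ^ ?m"
    by (simp add: power_add power_mult)
  moreover have "(3 :: int) ^ (2 * m1) = 9 ^ m1" "(2 :: int) ^ (2 * m1) = 4 ^ m1"
    by (simp_all add: power_mult)
  ultimately show ?thesis
    by simp
qed

section \<open>Primitivity\<close>

text \<open>If \<open>A\<close> contains the identity, then a coset containing \<open>A\<close> is the subgroup itself, and if
  \<open>A\<close> is a union of cosets of \<open>H\<close>, then \<open>H \<subseteq> A\<close> and \<open>H\<close> acts on \<open>A\<close>.\<close>

lemma primitive_subsetI:
  assumes G: "group G" and A: "A \<subseteq> carrier G" and one: "\<one>\<^bsub>G\<^esub> \<in> A"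
    and span: "\<And>H. subgroup H G \<Longrightarrow> A \<subseteq> H \<Longrightarrow> H = carrier G"
    and stab: "\<And>h. h \<in> A \<Longrightarrow> h \<otimes>\<^bsub>G\<^esub> h \<in> A \<Longrightarrow> (\<And>a. a \<in> A \<Longrightarrow> h \<otimes>\<^bsub>G\<^esub> a \<in> A) \<Longrightarrow> h = \<one>\<^bsub>G\<^esub>"
  shows "primitive_subset G A"
proof -
  interpret group G by fact
  have coset_one: "R = H" if H: "subgroup H G" and R: "R \<in> rcosets\<^bsub>G\<^esub> H" "\<one>\<^bsub>G\<^esub> \<in> R" for H R
  proof -
    obtain g where g: "g \<in> carrier G" "R = H #>\<^bsub>G\<^esub> g"
      using R(1) by (auto simp: RCOSETS_def)
    then have "\<one>\<^bsub>G\<^esub> \<in> H #>\<^bsub>G\<^esub> g"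
      using R(2) by simp
    then show ?thesis
      using repr_independence[OF _ g(1) H] g coset_mult_one[OF subgroup.subset[OF H]] by simp
  qed
  have "H = carrier G" if "subgroup H G" "R \<in> rcosets\<^bsub>G\<^esub> H" "A \<subseteq> R" for H R
    using coset_one[OF that(1,2)] span[OF that(1)] one that(3) by blast
  moreover have "H = {\<one>\<^bsub>G\<^esub>}" if H: "subgroup H G" and R: "\<R> \<subseteq> rcosets\<^bsub>G\<^esub> H" "A = \<Union>\<R>" for H \<R>
  proof -
    have "H \<in> \<R>"
      using one R coset_one[OF H] by blast
    then have HA: "H \<subseteq> A"
      using R by blast
    have "h = \<one>\<^bsub>G\<^esub>" if h: "h \<in> H" for h
    proof (rule stab)
      show "h \<in> A" "h \<otimes>\<^bsub>G\<^esub> h \<in> A"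
        using HA h subgroup.m_closed[OF H] by blast+
      fix a assume "a \<in> A"
      then obtain R where "a \<in> R" "R \<in> \<R>"
        using R by blast
      then obtain g where g: "g \<in> carrier G" "R = H #>\<^bsub>G\<^esub> g"
        using R by (auto simp: RCOSETS_def)
      then obtain k where k: "k \<in> H" "a = k \<otimes>\<^bsub>G\<^esub> g"
        using \<open>a \<in> R\<close> by (auto simp: r_coset_def)
      have "h \<otimes>\<^bsub>G\<^esub> a = (h \<otimes>\<^bsub>G\<^esub> k) \<otimes>\<^bsub>G\<^esub> g"
        using subgroup.mem_carrier[OF H] h k g by (simp add: m_assoc)
      then have "h \<otimes>\<^bsub>G\<^esub> a \<in> R"
        using subgroup.m_closed[OF H h k(1)] g(2) by (auto simp: r_coset_def)
      then show "h \<otimes>\<^bsub>G\<^esub> a \<in> A"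
        using R \<open>R \<in> \<R>\<close> by blast
    qed
    then show ?thesis
      using subgroup.one_closed[OF H] by blast
  qed
  ultimately show ?thesis
    unfolding primitive_subset_def using A by blast
qed

text \<open>The vector with the pair \<open>p\<close> in block \<open>j\<close> and zeros elsewhere.\<close>

definition single_block :: "nat \<Rightarrow> nat \<Rightarrow> int \<times> int \<Rightarrow> (nat \<Rightarrow> int)" where
  "single_block m j p = (\<lambda>i\<in>{..<2 * m}. if i div 2 = j then (if even i then fst p else snd p) else 0)"

lemma block_single_block: "j < m \<Longrightarrow> block (single_block m i p) j = (if j = i then p else (0, 0))"
  by (cases p) (simp add: single_block_def block_def)

lemma single_block_zero: "single_block m j (0, 0) = (\<lambda>i\<in>{..<2 * m}. 0)"
  unfolding single_block_def by (rule restrict_ext) simp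

lemma unit_vec_eq_single_block:
  "unit_vec (2 * m) k = single_block m (k div 2) (if even k then (1, 0) else (0, 1))"
proof
  fix i
  have "i = k \<longleftrightarrow> i div 2 = k div 2 \<and> (even i \<longleftrightarrow> even k)"
    by (metis even_two_times_div_two odd_two_times_div_two_succ)
  then show "unit_vec (2 * m) k i = single_block m (k div 2) (if even k then (1, 0) else (0, 1)) i"
    by (auto simp: unit_vec_def single_block_def)
qed

lemma single_block_in_pair_prod:
  assumes "p \<in> Z4_sq" "p \<in> N j" "\<And>i. (0, 0) \<in> N i"
  shows "single_block m j p \<in> pair_prod m N"
proof -
  have "single_block m j p \<in> extensional {..<2 * m}"
    by (simp add: single_block_def)
  then show ?thesis
    unfolding pair_prod_iff carrier_Z4_pow_iff using assms by (simp add: block_single_block)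
qed

lemma zero_in_planar_factor: "(0, 0) \<in> planar_factor m1 j"
  by (simp add: planar_factor_def J_sq_eq L_def)

lemma zero_in_signed_factor: "(0, 0) \<in> signed_factor m1 u j"
proof -
  have "(0, 0) = neg_pair (0, 0)"
    by (simp add: neg_pair_def)
  then have "(0, 0) \<in> neg_pair ` planar_factor m1 j"
    using zero_in_planar_factor by (rule image_eqI)
  then show ?thesis
    using zero_in_planar_factor by (simp add: signed_factor_def)
qed

lemmas zero_in_factors = zero_in_planar_factor zero_in_signed_factor

lemma units_in_planar_factor: "(1, 0) \<in> planar_factor m1 j" "(0, 1) \<in> planar_factor m1 j"
  by (simp_all add: planar_factor_def J_sq_eq L_def)

lemma unit_not_in_neg_factor: "(1, 0) \<notin> signed_factor m1 1 j"
  by (simp add: planar_factor_def signed_factor_def neg_J_sq_eq neg_L_eq)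

lemma zero_if_double_in_pair_prod:
  assumes "y \<in> pair_prod m (signed_factor m1 u)"
    and "(\<lambda>i\<in>{..<2 * m}. (y i + y i) mod 4) \<in> pair_prod m (planar_factor m1)"
  shows "y = (\<lambda>i\<in>{..<2 * m}. 0)"
proof (rule block_ext)
  show "y \<in> extensional {..<2 * m}"
    using assms(1) by (simp add: pair_prod_iff carrier_Z4_pow_iff)
  show "block y j = block (\<lambda>i\<in>{..<2 * m}. 0) j" if "j < m" for j
  proof -
    have "block y j = (0, 0)"
    proof (rule double_in_planar_factor)
      show "block y j \<in> signed_factor m1 u j"
        using assms(1) that by (simp add: pair_prod_iff)
      have "block (\<lambda>i\<in>{..<2 * m}. (y i + y i) mod 4) j \<in> planar_factor m1 j"
        using assms(2) that unfolding pair_prod_iff by blast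
      then show "((fst (block y j) + fst (block y j)) mod 4, (snd (block y j) + snd (block y j)) mod 4)
          \<in> planar_factor m1 j"
        unfolding block_restrict[OF that] by (simp add: block_def)
    qed
    then show ?thesis
      using that by (simp add: block_restrict)
  qed
qed simp

lemma primitive_subset_T':
  assumes "0 < m1 + m2"
  shows "primitive_subset (Z2_Z4_pow (2 * (m1 + m2))) (T' m1 m2)"
proof -
  let ?m = "m1 + m2" and ?G = "Z2_Z4_pow (2 * (m1 + m2))"
  have zero: "(\<lambda>i\<in>{..<2 * ?m}. 0) \<in> pair_prod ?m (signed_factor m1 u)" for u
    unfolding single_block_zero[symmetric, of ?m 0]
    by (rule single_block_in_pair_prod) (simp_all add: zero_in_factors)
  have unit: "(0, unit_vec (2 * ?m) k) \<in> T' m1 m2" for k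
    unfolding T'_eq unit_vec_eq_single_block
    using units_in_planar_factor zero_in_factors
    by (auto simp: signed_factor_def intro!: single_block_in_pair_prod)
  show ?thesis
  proof (rule primitive_subsetI[OF group_Z2_Z4_pow T'_subset])
    show "\<one>\<^bsub>?G\<^esub> \<in> T' m1 m2"
      unfolding one_Z2_Z4_pow T'_eq using zero by blast
    show "H = carrier ?G" if "subgroup H ?G" "T' m1 m2 \<subseteq> H" for H
    proof (rule subgroup_eq_Z2_Z4_powI[OF that(1)])
      show "(0, unit_vec (2 * ?m) k) \<in> H" for k
        using unit that(2) by blast
      have "(1, \<lambda>i\<in>{..<2 * ?m}. 0) \<in> T' m1 m2"
        unfolding T'_eq using zero by blast
      then show "(1, \<lambda>i\<in>{..<2 * ?m}. 0) \<in> H"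
        using that(2) by blast
    qed
    fix h
    assume h: "h \<in> T' m1 m2" "h \<otimes>\<^bsub>?G\<^esub> h \<in> T' m1 m2"
      and stab: "\<And>a. a \<in> T' m1 m2 \<Longrightarrow> h \<otimes>\<^bsub>?G\<^esub> a \<in> T' m1 m2"
    obtain w y where wy: "h = (w, y)"
      by (cases h)
    have w: "w = 0 \<or> w = 1" and y: "y \<in> pair_prod ?m (signed_factor m1 w)"
      using h(1) unfolding wy T'_eq by auto
    have "(w + w) mod 2 = 0"
      using w by auto
    then have "(\<lambda>i\<in>{..<2 * ?m}. (y i + y i) mod 4) \<in> pair_prod ?m (signed_factor m1 0)"
      using h(2) unfolding wy mult_Z2_Z4_pow T'_eq by simp
    moreover have "pair_prod ?m (signed_factor m1 0) = pair_prod ?m (planar_factor m1)"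
      by (rule pair_prod_cong) (simp add: signed_factor_def)
    ultimately have y0: "y = (\<lambda>i\<in>{..<2 * ?m}. 0)"
      using zero_if_double_in_pair_prod[OF y] by simp
    have "w \<noteq> 1"
    proof
      assume w1: "w = 1"
      \<comment> \<open>The first block of a unit vector of \<open>T\<close> is \<open>(1, 0)\<close>, which does not lie in \<open>-F\<^sub>0\<close>.\<close>
      let ?e = "unit_vec (2 * ?m) 0"
      have "(\<lambda>i\<in>{..<2 * ?m}. (y i + ?e i) mod 4) = ?e"
        unfolding y0 by (auto simp: unit_vec_def)
      then have "(1, ?e) \<in> T' m1 m2"
        using stab[OF unit[of 0]] unfolding wy w1 mult_Z2_Z4_pow by simp
      then have "block ?e 0 \<in> signed_factor m1 1 0"
        using assms unfolding T'_eq pair_prod_iff by auto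
      moreover have "block ?e 0 = (1, 0)"
        using assms by (simp add: unit_vec_eq_single_block block_single_block del: distrib_left_numeral)
      ultimately show False
        using unit_not_in_neg_factor by simp
    qed
    then show "h = \<one>\<^bsub>?G\<^esub>"
      using w unfolding wy y0 one_Z2_Z4_pow by simp
  qed
qed

lemma level_sign_single_block:
  assumes "j < m"
  shows "level_sign m1 m (single_block m j p) = Re ((1 - \<i>) * twist m1 j p)"
proof -
  have "(\<Prod>i<m. twist m1 i (block (single_block m j p) i)) = (\<Prod>i<m. if i = j then twist m1 j p else 1)"
    by (rule prod.cong) (auto simp: block_single_block twist_def)
  then show ?thesis
    using assms by (simp add: level_sign_def)
qed

lemma Re_twist_eq_1:
  assumes "p \<in> {(0, 0), (1, 0), (0, 1)}"
  shows "Re ((1 - \<i>) * twist m1 j p) = 1"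
proof -
  have "twist m1 j p = 1 \<or> twist m1 j p = \<i>"
    using assms by (auto simp: twist_def)
  then show ?thesis
    by auto
qed

lemma primitive_subset_S':
  assumes "0 < m1 + m2"
  shows "primitive_subset (Z2_Z4_pow (2 * (m1 + m2))) (S' m1 m2)"
proof -
  let ?m = "m1 + m2" and ?G = "Z2_Z4_pow (2 * (m1 + m2))"
  have mem: "(if Re ((1 - \<i>) * twist m1 j p) = 1 then 0 else 1, single_block ?m j p) \<in> S' m1 m2"
    if "j < ?m" "p \<in> planar_factor m1 j" for j p
  proof -
    have "single_block ?m j p \<in> pair_prod ?m (planar_factor m1)"
      using that(2) factor_subset zero_in_factors by (intro single_block_in_pair_prod) auto
    then show ?thesis
      unfolding S'_eq level_sign_single_block[OF that(1), symmetric] by (rule imageI)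
  qed
  have one: "\<one>\<^bsub>?G\<^esub> \<in> S' m1 m2"
    using mem[OF assms zero_in_planar_factor] Re_twist_eq_1[of "(0, 0)" m1 0]
    by (simp only: one_Z2_Z4_pow single_block_zero insert_iff simp_thms if_True)
  have level_zero: "w = 0" if "(w, \<lambda>i\<in>{..<2 * ?m}. 0) \<in> S' m1 m2" for w
    using one that unfolding S'_eq one_Z2_Z4_pow by auto
  show ?thesis
  proof (rule primitive_subsetI[OF group_Z2_Z4_pow S'_subset one])
    show "H = carrier ?G" if "subgroup H ?G" "S' m1 m2 \<subseteq> H" for H
    proof (rule subgroup_eq_Z2_Z4_powI[OF that(1)])
      show "(0, unit_vec (2 * ?m) k) \<in> H" if "k < 2 * ?m" for k
      proof -
        have "k div 2 < ?m"
          using that by simp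
        then have "(0, unit_vec (2 * ?m) k) \<in> S' m1 m2"
          using mem[of "k div 2" "(1, 0)"] mem[of "k div 2" "(0, 1)"] units_in_planar_factor
            Re_twist_eq_1[of "(1, 0)" m1 "k div 2"] Re_twist_eq_1[of "(0, 1)" m1 "k div 2"]
          by (simp add: unit_vec_eq_single_block del: distrib_left_numeral)
        then show ?thesis
          using \<open>S' m1 m2 \<subseteq> H\<close> by blast
      qed
      \<comment> \<open>A point of the first factor with twist \<open>-1\<close>, which puts it on level 1.\<close>
      define p :: "int \<times> int" where "p = (if 0 < m1 then (1, 1) else (3, 3))"
      have "p \<in> planar_factor m1 0" "twist m1 0 p = - 1"
        by (auto simp: p_def planar_factor_def twist_def J_sq_eq L_def)
      then have "(1, single_block ?m 0 p) \<in> S' m1 m2"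
        using mem[OF assms, of p] by simp
      then show "(1, single_block ?m 0 p) \<in> H"
        using that(2) by blast
    qed
    fix h
    assume h: "h \<in> S' m1 m2" "h \<otimes>\<^bsub>?G\<^esub> h \<in> S' m1 m2"
    obtain w y where wy: "h = (w, y)"
      by (cases h)
    have "y \<in> pair_prod ?m (planar_factor m1)"
      using h(1) unfolding wy S'_eq by blast
    then have "y \<in> pair_prod ?m (signed_factor m1 0)"
      by (simp add: pair_prod_iff signed_factor_def)
    moreover have "(\<lambda>i\<in>{..<2 * ?m}. (y i + y i) mod 4) \<in> pair_prod ?m (planar_factor m1)"
      using h(2) unfolding wy mult_Z2_Z4_pow S'_eq by blast
    ultimately have y0: "y = (\<lambda>i\<in>{..<2 * ?m}. 0)"
      by (rule zero_if_double_in_pair_prod)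
    then show "h = \<one>\<^bsub>?G\<^esub>"
      using h(1) level_zero unfolding wy one_Z2_Z4_pow by blast
  qed
qed

theorem theorem6p5:
  fixes m m1 m2 :: nat
  assumes "m > 0" and "m = m1 + m2"
  shows "(S10 m1 \<union> S11 m1 = S1 m1 \<and> S10 m1 \<inter> S11 m1 = {}) \<and>
    (S20 m2 \<union> S21 m2 = S2 m2 \<and> S20 m2 \<inter> S21 m2 = {}) \<and>
    primitive_formally_dual_pair (Z2_Z4_pow (2 * m)) (canonical_iso (2 * m)) (S' m1 m2) (T' m1 m2) \<and>
    int (theta (T' m1 m2) (Z2_Z4_pow (2 * m))) =
      2 ^ (4 * m + 1) - 3 ^ (2 * m1) * 13 ^ m2 - (2 * 3 ^ (2 * m1) - 2 ^ (2 * m1)) * 10 ^ m2"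
  unfolding primitive_formally_dual_pair_def \<open>m = m1 + m2\<close>
proof (intro conjI)
  have pos: "0 < m1 + m2"
    using assms by simp
  show "primitive_subset (Z2_Z4_pow (2 * (m1 + m2))) (S' m1 m2)"
    using pos by (rule primitive_subset_S')
  show "primitive_subset (Z2_Z4_pow (2 * (m1 + m2))) (T' m1 m2)"
    using pos by (rule primitive_subset_T')
qed (rule S1_partition S2_partition formally_dual_pair_S'_T' theta_T')+

end
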